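(* Let $\boldsymbol{\alpha}=(\alpha_1,\alpha_2)\in\mathbb{R}^2$ be such that $\{1,\alpha_1,\alpha_2\}$ is a $\mathbb{Q}$-basis for a cubic field $K/\mathbb{Q}$, and let $\Lambda^*$ be the lattice in $K$ dual to $\Lambda=\mathbb{Z}+\alpha_1\mathbb{Z}+\alpha_2\mathbb{Z}$ with respect to the trace form. (1) If $K$ has a nontrivial (non-real) complex embedding, then there is an ellipse $\mathcal{C}_K\subset\mathbb{R}^2$ such that \[\mathcal{A}_{1/2}(\boldsymbol{\alpha})=\bigcup_{s\in \Lambda^*\setminus\{0\}}|\mathrm{N}(s)|^{1/2}\,\mathcal{C}_K.\] (2) If $K$ is totally real, then there is a hyperbola $\mathcal{C}_K^+\subset\mathbb{R}^2$ such that \[\mathcal{A}_{1/2}(\boldsymbol{\alpha})=\bigcup_{s\in \Lambda^*\setminus\{0\}}|\mathrm{N}(s)|^{1/2}\,\ell_{s}(\mathcal{C}_K^+),\] where for each $s\in\Lambda^*\setminus\{0\}$ the map $\ell_s:\mathbb{R}^2\to\mathbb{R}^2$ is either the identity map or a linear map taking $\mathcal{C}_K^+$ to its conjugate hyperbola.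
   Context: For $\boldsymbol{\alpha}\in\mathbb{R}^2$, $\mathcal{A}_{1/2}(\boldsymbol{\alpha})$ is the set of accumulation points in $\mathbb{R}^2$ of $\{|q|^{1/2}(q\boldsymbol{\alpha}-\boldsymbol{p}):q\in\mathbb{Z}\setminus\{0\},\ \boldsymbol{p}\in\mathbb{Z}^2\}$. $\mathrm{N}$ and $\mathrm{Tr}$ are the norm and trace from $K$ to $\mathbb{Q}$; the trace form is $\langle x,y\rangle=\mathrm{Tr}(xy)$, and the dual lattice is $\Lambda^*=\{x\in K:\mathrm{Tr}(xy)\in\mathbb{Z}\ \forall y\in\Lambda\}$ (equivalently, the $\mathbb{Z}$-span of the basis dual to $\{1,\alpha_1,\alpha_2\}$ with respect to the trace form). For a centered hyperbola $\{v\in\mathbb{R}^2: Q(v)=1\}$ with $Q$ an indefinite quadratic form, its conjugate hyperbola is $\{v: Q(v)=-1\}$. Multiplying a set by a positive scalar means homothetic dilation about the origin. *)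

theory Defs
  imports "HOL-Analysis.Analysis"
begin

definition Kset :: "real \<Rightarrow> real \<Rightarrow> real set" where
  "Kset a1 a2 = {c0 + c1 * a1 + c2 * a2 | c0 c1 c2. c0 \<in> \<rat> \<and> c1 \<in> \<rat> \<and> c2 \<in> \<rat>}"

definition Lat :: "real \<Rightarrow> real \<Rightarrow> real set" where
  "Lat a1 a2 = {of_int m0 + of_int m1 * a1 + of_int m2 * a2 | m0 m1 m2. True}"

definition cubic_field_basis :: "real \<Rightarrow> real \<Rightarrow> bool" where
  "cubic_field_basis a1 a2 \<longleftrightarrow>
     (\<forall>c0 c1 c2. c0 \<in> \<rat> \<and> c1 \<in> \<rat> \<and> c2 \<in> \<rat> \<and> c0 + c1 * a1 + c2 * a2 = 0
          \<longrightarrow> c0 = 0 \<and> c1 = 0 \<and> c2 = 0)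
   \<and> (\<forall>x \<in> Kset a1 a2. \<forall>y \<in> Kset a1 a2. x * y \<in> Kset a1 a2)
   \<and> (\<forall>x \<in> Kset a1 a2. x \<noteq> 0 \<longrightarrow> inverse x \<in> Kset a1 a2)"

definition kbasis :: "real \<Rightarrow> real \<Rightarrow> nat \<Rightarrow> real" where
  "kbasis a1 a2 i = (if i = 0 then 1 else if i = 1 then a1 else a2)"

definition kcoord :: "real \<Rightarrow> real \<Rightarrow> real \<Rightarrow> nat \<Rightarrow> real" where
  "kcoord a1 a2 x = (THE c. (\<forall>i<3. c i \<in> \<rat>) \<and> (\<forall>i\<ge>3. c i = 0) \<and>
                        x = (\<Sum>i<3. c i * kbasis a1 a2 i))"

definition mult_mat :: "real \<Rightarrow> real \<Rightarrow> real \<Rightarrow> nat \<Rightarrow> nat \<Rightarrow> real" where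
  "mult_mat a1 a2 x i j = kcoord a1 a2 (x * kbasis a1 a2 j) i"

definition ktrace :: "real \<Rightarrow> real \<Rightarrow> real \<Rightarrow> real" where
  "ktrace a1 a2 x = (\<Sum>i<3. mult_mat a1 a2 x i i)"

definition knorm :: "real \<Rightarrow> real \<Rightarrow> real \<Rightarrow> real" where
  "knorm a1 a2 x = (\<Sum>p | p permutes {..<3::nat}.
                      of_int (sign p) * (\<Prod>i<3. mult_mat a1 a2 x i (p i)))"

definition dual_lat :: "real \<Rightarrow> real \<Rightarrow> real set" where
  "dual_lat a1 a2 = {x \<in> Kset a1 a2. \<forall>y \<in> Lat a1 a2. ktrace a1 a2 (x * y) \<in> \<int>}"

definition complex_embedding :: "real \<Rightarrow> real \<Rightarrow> (real \<Rightarrow> complex) \<Rightarrow> bool" where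
  "complex_embedding a1 a2 \<sigma> \<longleftrightarrow> \<sigma> 1 = 1 \<and>
     (\<forall>x \<in> Kset a1 a2. \<forall>y \<in> Kset a1 a2. \<sigma> (x + y) = \<sigma> x + \<sigma> y \<and> \<sigma> (x * y) = \<sigma> x * \<sigma> y)"

definition has_nonreal_embedding :: "real \<Rightarrow> real \<Rightarrow> bool" where
  "has_nonreal_embedding a1 a2 \<longleftrightarrow>
     (\<exists>\<sigma>. complex_embedding a1 a2 \<sigma> \<and> (\<exists>x \<in> Kset a1 a2. Im (\<sigma> x) \<noteq> 0))"

definition totally_real :: "real \<Rightarrow> real \<Rightarrow> bool" where
  "totally_real a1 a2 \<longleftrightarrow>
     (\<forall>\<sigma>. complex_embedding a1 a2 \<sigma> \<longrightarrow> (\<forall>x \<in> Kset a1 a2. Im (\<sigma> x) = 0))"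

definition approx_set :: "real \<Rightarrow> real \<Rightarrow> (real \<times> real) set" where
  "approx_set a1 a2 = {(sqrt \<bar>real_of_int q\<bar> * (of_int q * a1 - of_int p1),
                        sqrt \<bar>real_of_int q\<bar> * (of_int q * a2 - of_int p2)) | q p1 p2. q \<noteq> 0}"

definition A_half :: "real \<Rightarrow> real \<Rightarrow> (real \<times> real) set" where
  "A_half a1 a2 = {v. v islimpt approx_set a1 a2}"

definition qform :: "real \<Rightarrow> real \<Rightarrow> real \<Rightarrow> real \<times> real \<Rightarrow> real" where
  "qform a b c v = a * (fst v)^2 + 2 * b * fst v * snd v + c * (snd v)^2"

definition is_ellipse :: "(real \<times> real) set \<Rightarrow> bool" where
  "is_ellipse E \<longleftrightarrow> (\<exists>a b c z. a > 0 \<and> a * c - b^2 > 0 \<and> E = {v. qform a b c (v - z) = 1})"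

definition dilate :: "real \<Rightarrow> (real \<times> real) set \<Rightarrow> (real \<times> real) set" where
  "dilate r S = (\<lambda>v. r *\<^sub>R v) ` S"

end

theory Submission
  imports Defs
begin

text \<open>Let \<sigma>, \<tau> be the two conjugate embeddings of K besides the inclusion. An integer point (q, p1, p2) is the
  vector of traces of a unique \<xi> in the dual lattice against 1, a1, a2, and
  q a_i - p_i = \<sigma> \<xi> (a_i - \<sigma> a_i) + \<tau> \<xi> (a_i - \<tau> a_i). So in suitable linear coordinates (X, Y) the
  approximation vectors are |q|^(1/2) (\<sigma> \<xi>, \<tau> \<xi>); when they stay bounded and q grows, q is asymptotic to \<xi>, and
  X Y is asymptotic to |\<xi>| \<sigma> \<xi> \<tau> \<xi> = sgn \<xi> N(\<xi>), which lies in a discrete set. Hence every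
  accumulation point satisfies X Y = sgn s N(s) for some nonzero s in the dual lattice.

  Conversely, all of such a curve is attained by the multiples of s by units u: they leave X Y unchanged, and
  \<sigma> u / \<tau> u comes arbitrarily close to every admissible value. Only one consequence of the unit theorem is
  needed for this, namely large units u with \<sigma> u / \<tau> u close to but different from 1, and it follows from
  Dirichlet's approximation theorem and the pigeonhole principle.\<close>

section \<open>The field K\<close>

text \<open>The dual lattice D need not be a ring, so integrality enters as bounded denominators:
  one integer clears the products of any two elements of D, another every cofactor N(s)/s, a third
  every norm. This gives both the discreteness of the norms and the pigeonhole step for units, where
  the units are those multiplying D onto itself.

  Units must do two things at once: their ratio of conjugates has to approach a prescribed value,
  and their size has to tend to infinity, because accumulation requires q unbounded. Small steps
  along a one-parameter group (the circle or the positive reals) provide the first, and the size of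
  the stepping unit provides the second.

  The ratio X/Y fixes a point of a curve X Y = const only up to sign. The missing sign is supplied
  by passing from \<xi> to -\<xi>, under which the signed norm does not change.

  Both signatures share one set of complex coordinates; they separate only at the density of the
  ratios and at the type of the quadratic form X Y.\<close>

lemma KsetI: "c0 \<in> \<rat> \<Longrightarrow> c1 \<in> \<rat> \<Longrightarrow> c2 \<in> \<rat> \<Longrightarrow> c0 + c1 * a1 + c2 * a2 \<in> Kset a1 a2"
  unfolding Kset_def by blast

lemma KsetE:
  assumes "x \<in> Kset a1 a2"
  obtains c0 c1 c2 where "c0 \<in> \<rat>" "c1 \<in> \<rat>" "c2 \<in> \<rat>" "x = c0 + c1 * a1 + c2 * a2"
  using assms unfolding Kset_def by blast

lemma Kset_rat: "r \<in> \<rat> \<Longrightarrow> r \<in> Kset a1 a2"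
  using KsetI[of r 0 0 a1 a2] by simp

lemma Kset_gens: "a1 \<in> Kset a1 a2" "a2 \<in> Kset a1 a2"
  using KsetI[of 0 1 0 a1 a2] KsetI[of 0 0 1 a1 a2] by simp_all

lemma Kset_add:
  assumes "x \<in> Kset a1 a2" "y \<in> Kset a1 a2"
  shows "x + y \<in> Kset a1 a2"
proof -
  obtain c0 c1 c2 where c: "c0 \<in> \<rat>" "c1 \<in> \<rat>" "c2 \<in> \<rat>" "x = c0 + c1 * a1 + c2 * a2"
    using assms(1) by (rule KsetE)
  obtain d0 d1 d2 where d: "d0 \<in> \<rat>" "d1 \<in> \<rat>" "d2 \<in> \<rat>" "y = d0 + d1 * a1 + d2 * a2"
    using assms(2) by (rule KsetE)
  have "x + y = (c0 + d0) + (c1 + d1) * a1 + (c2 + d2) * a2"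
    using c d by (simp add: algebra_simps)
  then show ?thesis using c(1-3) d(1-3) by (metis KsetI Rats_add)
qed

lemma cubic_indep:
  assumes "cubic_field_basis a1 a2" "c0 \<in> \<rat>" "c1 \<in> \<rat>" "c2 \<in> \<rat>" "c0 + c1 * a1 + c2 * a2 = 0"
  shows "c0 = 0" "c1 = 0" "c2 = 0"
  using assms unfolding cubic_field_basis_def by blast+

lemma cubic_mult:
  assumes "cubic_field_basis a1 a2" "x \<in> Kset a1 a2" "y \<in> Kset a1 a2"
  shows "x * y \<in> Kset a1 a2"
  using assms unfolding cubic_field_basis_def by blast

lemma cubic_inverse:
  assumes "cubic_field_basis a1 a2" "x \<in> Kset a1 a2"
  shows "inverse x \<in> Kset a1 a2"
  using assms unfolding cubic_field_basis_def by (metis inverse_zero)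

lemma cubic_divide:
  assumes "cubic_field_basis a1 a2" "x \<in> Kset a1 a2" "y \<in> Kset a1 a2"
  shows "x / y \<in> Kset a1 a2"
  by (simp add: divide_inverse assms cubic_mult cubic_inverse)

lemma cubic_uminus:
  assumes "cubic_field_basis a1 a2" "x \<in> Kset a1 a2"
  shows "- x \<in> Kset a1 a2"
  using cubic_mult[OF assms(1) Kset_rat[of "-1"] assms(2)] by simp

lemma cubic_diff:
  assumes "cubic_field_basis a1 a2" "x \<in> Kset a1 a2" "y \<in> Kset a1 a2"
  shows "x - y \<in> Kset a1 a2"
  using Kset_add[OF assms(2) cubic_uminus[OF assms(1,3)]] by simp

text \<open>The description in \<open>kcoord\<close> is unique for two reasons: rational
  independence fixes the first three values, and the prescribed value 0 fixes the function at all
  other indices.\<close>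

lemma kcoord_eq:
  assumes cub: "cubic_field_basis a1 a2" and c: "c0 \<in> \<rat>" "c1 \<in> \<rat>" "c2 \<in> \<rat>"
  shows "kcoord a1 a2 (c0 + c1 * a1 + c2 * a2) =
           (\<lambda>i. if i = 0 then c0 else if i = 1 then c1 else if i = 2 then c2 else 0)"
  unfolding kcoord_def
proof (rule the_equality)
  fix d assume "(\<forall>i<3. d i \<in> \<rat>) \<and> (\<forall>i\<ge>3. d i = 0) \<and>
     c0 + c1 * a1 + c2 * a2 = (\<Sum>i<3. d i * kbasis a1 a2 i)"
  then have d: "d 0 \<in> \<rat>" "d 1 \<in> \<rat>" "d 2 \<in> \<rat>" "\<And>i. i \<ge> 3 \<Longrightarrow> d i = 0"
    and eq: "c0 + c1 * a1 + c2 * a2 = d 0 + d 1 * a1 + d 2 * a2"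
    by (auto simp: numeral_3_eq_3 kbasis_def numeral_2_eq_2)
  have "(c0 - d 0) + (c1 - d 1) * a1 + (c2 - d 2) * a2 = 0"
    using eq by (simp add: algebra_simps)
  then have "c0 = d 0" "c1 = d 1" "c2 = d 2"
    using cubic_indep[OF cub, of "c0 - d 0" "c1 - d 1" "c2 - d 2"] c d by auto
  then show "d = (\<lambda>i. if i = 0 then c0 else if i = 1 then c1 else if i = 2 then c2 else 0)"
  proof (intro ext)
    fix i :: nat
    consider "i = 0" | "i = 1" | "i = 2" | "i \<ge> 3" by linarith
    then show "d i = (if i = 0 then c0 else if i = 1 then c1 else if i = 2 then c2 else 0)"
      by cases (use d(4) \<open>c0 = d 0\<close> \<open>c1 = d 1\<close> \<open>c2 = d 2\<close> in auto)
  qed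
qed (use c in \<open>auto simp: numeral_3_eq_3 kbasis_def\<close>)

text \<open>If a1^2 lay in the span of 1 and a1, then the expansion of a1 * a2 would put a2 into that span as well.\<close>

lemma cubic_primitive:
  assumes cub: "cubic_field_basis a1 a2"
  obtains r0 r1 r2 where "r0 \<in> \<rat>" "r1 \<in> \<rat>" "r2 \<in> \<rat>" "r2 \<noteq> 0" "a2 = r0 + r1 * a1 + r2 * a1\<^sup>2"
proof -
  obtain c0 c1 c2 where c: "c0 \<in> \<rat>" "c1 \<in> \<rat>" "c2 \<in> \<rat>" "a1 * a1 = c0 + c1 * a1 + c2 * a2"
    using cubic_mult[OF cub Kset_gens(1) Kset_gens(1)] by (rule KsetE)
  obtain d0 d1 d2 where d: "d0 \<in> \<rat>" "d1 \<in> \<rat>" "d2 \<in> \<rat>" "a1 * a2 = d0 + d1 * a1 + d2 * a2"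
    using cubic_mult[OF cub Kset_gens(1) Kset_gens(2)] by (rule KsetE)
  have "c2 \<noteq> 0"
  proof
    assume z: "c2 = 0"
    \<comment> \<open>Since \<open>(a1 - d2) * a2 = d0 + d1 * a1\<close>, the factor
      \<open>a1 - d2\<close> moves \<open>a2\<close> into the span of 1 and \<open>a1\<close>. The
      other factor is, up to sign, the conjugate of the first under \<open>a1\<close> ->
      \<open>c1 - a1\<close>, so the product \<open>r\<close> is rational and \<open>r * a2\<close>
      lies in that span; this forces \<open>r = 0\<close> and hence \<open>a1\<close>
      rational.\<close>
    define r where "r = c0 - d2\<^sup>2 + c1 * d2"
    have r: "(a1 - d2) * (a1 + d2 - c1) = r"
      using c(4) z unfolding r_def by (simp add: algebra_simps power2_eq_square)
    have rQ: "r \<in> \<rat>" unfolding r_def using c d by simp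
    have "r * a2 = (a1 * a2 - d2 * a2) * (a1 + d2 - c1)"
      unfolding r[symmetric] by (simp add: algebra_simps)
    also have "\<dots> = (d0 + d1 * a1) * (a1 + d2 - c1)"
      using d(4) by simp
    also have "\<dots> = d1 * (a1 * a1) + (d0 + d1 * d2 - d1 * c1) * a1 + d0 * (d2 - c1)"
      by (simp add: algebra_simps)
    also have "\<dots> = (d1 * c0 + d0 * (d2 - c1)) + (d0 + d1 * d2 - d1 * c1 + d1 * c1) * a1"
      unfolding c(4) z by (simp add: algebra_simps)
    finally have "(d1 * c0 + d0 * (d2 - c1)) + (d0 + d1 * d2 - d1 * c1 + d1 * c1) * a1 + (- r) * a2 = 0"
      by simp
    then have "r = 0"
      using cubic_indep(3)[OF cub, of "d1 * c0 + d0 * (d2 - c1)" "d0 + d1 * d2 - d1 * c1 + d1 * c1" "- r"] c d rQ by auto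
    then have "(- d2) + 1 * a1 + 0 * a2 = 0 \<or> (d2 - c1) + 1 * a1 + 0 * a2 = 0"
      using r by auto
    then show False
      using cubic_indep(2)[OF cub, of "- d2" 1 0] cubic_indep(2)[OF cub, of "d2 - c1" 1 0] c d by auto
  qed
  show ?thesis
  proof (rule that[of "- c0 / c2" "- c1 / c2" "1 / c2"])
    show "a2 = - c0 / c2 + - c1 / c2 * a1 + 1 / c2 * a1\<^sup>2"
      using c(4) \<open>c2 \<noteq> 0\<close> by (simp add: field_simps power2_eq_square)
  qed (use c \<open>c2 \<noteq> 0\<close> in auto)
qed

text \<open>Makes \<open>a1\<close> a generator of K, so that an embedding is determined by its
  value at \<open>a1\<close> and relations of degree at most 2 in \<open>a1\<close> can be compared
  coefficientwise.\<close>

lemma cubic_power_basis: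
  assumes cub: "cubic_field_basis a1 a2"
  shows "cubic_field_basis a1 (a1\<^sup>2)" and "Kset a1 (a1\<^sup>2) = Kset a1 a2"
proof -
  obtain r0 r1 r2 where r: "r0 \<in> \<rat>" "r1 \<in> \<rat>" "r2 \<in> \<rat>" "r2 \<noteq> 0" "a2 = r0 + r1 * a1 + r2 * a1\<^sup>2"
    using cubic_primitive[OF cub] .
  have 1: "x \<in> Kset a1 (a1\<^sup>2)" if x: "x \<in> Kset a1 a2" for x
  proof -
    obtain c0 c1 c2 where c: "c0 \<in> \<rat>" "c1 \<in> \<rat>" "c2 \<in> \<rat>" "x = c0 + c1 * a1 + c2 * a2"
      using x by (rule KsetE)
    have "x = (c0 + c2 * r0) + (c1 + c2 * r1) * a1 + (c2 * r2) * a1\<^sup>2"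
      unfolding c(4) by (subst r(5)) (simp add: algebra_simps)
    then show ?thesis using c(1-3) r(1-3) by (metis KsetI Rats_add Rats_mult)
  qed
  have 2: "x \<in> Kset a1 a2" if x: "x \<in> Kset a1 (a1\<^sup>2)" for x
    using x
  proof (rule KsetE)
    fix c0 c1 c2 assume c: "c0 \<in> \<rat>" "c1 \<in> \<rat>" "c2 \<in> \<rat>" "x = c0 + c1 * a1 + c2 * a1\<^sup>2"
    show ?thesis unfolding c(4) power2_eq_square
      by (intro Kset_add cubic_mult[OF cub] Kset_rat Kset_gens c)
  qed
  show eq: "Kset a1 (a1\<^sup>2) = Kset a1 a2" using 1 2 by blast
  have "c0 = 0 \<and> c1 = 0 \<and> c2 = 0"
    if c: "c0 \<in> \<rat>" "c1 \<in> \<rat>" "c2 \<in> \<rat>" "c0 + c1 * a1 + c2 * a1\<^sup>2 = 0" for c0 c1 c2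
  proof -
    have sq: "a1\<^sup>2 = - r0 / r2 + - r1 / r2 * a1 + 1 / r2 * a2"
      using r by (simp add: field_simps)
    have "(c0 - c2 * r0 / r2) + (c1 - c2 * r1 / r2) * a1 + (c2 / r2) * a2 = 0"
      using c(4) unfolding sq by (simp add: algebra_simps)
    moreover have "c0 - c2 * r0 / r2 \<in> \<rat>" "c1 - c2 * r1 / r2 \<in> \<rat>" "c2 / r2 \<in> \<rat>"
      using c r by auto
    ultimately show ?thesis
      using cubic_indep[OF cub, of "c0 - c2 * r0 / r2" "c1 - c2 * r1 / r2" "c2 / r2"] r(4) by auto
  qed
  then show "cubic_field_basis a1 (a1\<^sup>2)"
    unfolding cubic_field_basis_def eq
    using cubic_mult[OF cub] cubic_inverse[OF cub] by blast
qed

lemma embedding_rat: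
  assumes "complex_embedding a1 a2 \<sigma>" "r \<in> \<rat>"
  shows "\<sigma> r = of_real r"
proof -
  have Q: "x \<in> Kset a1 a2" if "x \<in> \<rat>" for x using that by (rule Kset_rat)
  have one: "\<sigma> 1 = 1" and add: "\<sigma> (x + y) = \<sigma> x + \<sigma> y" and mult: "\<sigma> (x * y) = \<sigma> x * \<sigma> y"
    if "x \<in> \<rat>" "y \<in> \<rat>" for x y
    using assms(1) Q that unfolding complex_embedding_def by auto
  have zero: "\<sigma> 0 = 0" using add[of 0 0] by simp
  have nat: "\<sigma> (real n) = of_nat n" for n
  proof (induction n)
    case (Suc n)
    have "\<sigma> (real (Suc n)) = \<sigma> (real n) + \<sigma> 1"
      using add[of "real n" 1] by (simp add: add.commute)
    then show ?case using Suc one[of 0 0] by simp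
  qed (simp add: zero)
  have neg: "\<sigma> (- x) = - \<sigma> x" if "x \<in> \<rat>" for x
    using add[of x "- x"] that zero by (simp add: add_eq_0_iff)
  have int: "\<sigma> (real_of_int k) = of_int k" for k
    by (cases k rule: int_cases2) (simp_all add: nat neg)
  obtain a b where ab: "b \<noteq> 0" "r = real_of_int a / real_of_int b"
    using assms(2) by (metis Rats_cases' less_irrefl)
  have "\<sigma> (r * real_of_int b) = \<sigma> r * of_int b"
    using mult[of r "real_of_int b"] assms(2) int by simp
  moreover have "r * real_of_int b = real_of_int a" using ab by simp
  ultimately have "\<sigma> r * of_int b = of_int a" using int by simp
  moreover have "complex_of_real r * of_int b = of_int a"
    using \<open>r * real_of_int b = real_of_int a\<close> by (metis of_real_mult of_real_of_int_eq)
  ultimately show ?thesis using ab(1) by (metis mult_right_cancel of_int_eq_0_iff)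
qed

section \<open>Embeddings, trace and norm\<close>

lemma embedding_add:
  assumes "complex_embedding a1 a2 \<sigma>" "x \<in> Kset a1 a2" "y \<in> Kset a1 a2"
  shows "\<sigma> (x + y) = \<sigma> x + \<sigma> y"
  using assms unfolding complex_embedding_def by blast

lemma embedding_mult:
  assumes "complex_embedding a1 a2 \<sigma>" "x \<in> Kset a1 a2" "y \<in> Kset a1 a2"
  shows "\<sigma> (x * y) = \<sigma> x * \<sigma> y"
  using assms unfolding complex_embedding_def by blast

lemma embedding_lincomb:
  assumes cub: "cubic_field_basis a1 a2" and emb: "complex_embedding a1 a2 \<sigma>"
    and "c0 \<in> \<rat>" "c1 \<in> \<rat>" "c2 \<in> \<rat>" "x \<in> Kset a1 a2" "y \<in> Kset a1 a2"
  shows "\<sigma> (c0 + c1 * x + c2 * y) = of_real c0 + of_real c1 * \<sigma> x + of_real c2 * \<sigma> y"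
proof -
  have K: "c0 \<in> Kset a1 a2" "c1 \<in> Kset a1 a2" "c2 \<in> Kset a1 a2"
    using assms by (simp_all add: Kset_rat)
  note mem = K assms(6,7) Kset_add cubic_mult[OF cub]
  show ?thesis
    using assms(3-5) by (simp add: embedding_add[OF emb] embedding_mult[OF emb] mem embedding_rat[OF emb])
qed

lemma embedding_uminus:
  assumes "complex_embedding a1 a2 \<sigma>" "x \<in> Kset a1 a2"
  shows "\<sigma> (- x) = - \<sigma> x"
  using embedding_mult[OF assms(1) Kset_rat[of "-1"] assms(2)] embedding_rat[OF assms(1), of "-1"] by simp

lemma embedding_nonzero:
  assumes "cubic_field_basis a1 a2" "complex_embedding a1 a2 \<sigma>" "x \<in> Kset a1 a2" "x \<noteq> 0"
  shows "\<sigma> x \<noteq> 0"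
proof -
  have "\<sigma> x * \<sigma> (inverse x) = \<sigma> 1"
    using embedding_mult[OF assms(2,3) cubic_inverse[OF assms(1,3)]] assms(4) by simp
  then show ?thesis using assms(2) unfolding complex_embedding_def by auto
qed

lemma embedding_divide:
  assumes "cubic_field_basis a1 a2" "complex_embedding a1 a2 \<sigma>" "x \<in> Kset a1 a2" "y \<in> Kset a1 a2" "y \<noteq> 0"
  shows "\<sigma> (x / y) = \<sigma> x / \<sigma> y"
  using embedding_mult[OF assms(2) cubic_divide[OF assms(1,3,4)] assms(4)]
    embedding_nonzero[OF assms(1,2,4,5)] assms(5) by (simp add: field_simps)

lemma embedding_of_real: "complex_embedding a1 a2 complex_of_real"
  unfolding complex_embedding_def by simp

lemma mult_mat_rat:
  assumes cub: "cubic_field_basis a1 a2" and x: "x \<in> Kset a1 a2" and "i < 3"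
  shows "mult_mat a1 a2 x i j \<in> \<rat>"
proof -
  have "kbasis a1 a2 j \<in> Kset a1 a2"
    unfolding kbasis_def by (simp add: Kset_gens Kset_rat)
  then have "x * kbasis a1 a2 j \<in> Kset a1 a2" by (rule cubic_mult[OF cub x])
  then obtain c0 c1 c2 where c: "c0 \<in> \<rat>" "c1 \<in> \<rat>" "c2 \<in> \<rat>"
    "x * kbasis a1 a2 j = c0 + c1 * a1 + c2 * a2" by (rule KsetE)
  then show ?thesis
    unfolding mult_mat_def c(4) kcoord_eq[OF cub c(1-3)] by simp
qed

text \<open>The row (1, \<open>\<sigma> a1\<close>, \<open>\<sigma> a2\<close>) is a left
  eigenvector of the multiplication matrix with eigenvalue \<open>\<sigma> x\<close>: apply \<sigma>
  to the expansion of each product of \<open>x\<close> with a basis element. Three embeddings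
  together diagonalise the matrix.\<close>

lemma mult_mat_eigenvector:
  assumes cub: "cubic_field_basis a1 a2" and x: "x \<in> Kset a1 a2"
    and emb: "complex_embedding a1 a2 \<sigma>"
  shows "of_real (mult_mat a1 a2 x 0 j) + of_real (mult_mat a1 a2 x 1 j) * \<sigma> a1
       + of_real (mult_mat a1 a2 x 2 j) * \<sigma> a2 = \<sigma> x * \<sigma> (kbasis a1 a2 j)"
proof -
  have b: "kbasis a1 a2 j \<in> Kset a1 a2"
    unfolding kbasis_def by (simp add: Kset_gens Kset_rat)
  then have "x * kbasis a1 a2 j \<in> Kset a1 a2" by (rule cubic_mult[OF cub x])
  then obtain c0 c1 c2 where c: "c0 \<in> \<rat>" "c1 \<in> \<rat>" "c2 \<in> \<rat>"
    "x * kbasis a1 a2 j = c0 + c1 * a1 + c2 * a2" by (rule KsetE)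
  have "\<sigma> x * \<sigma> (kbasis a1 a2 j) = \<sigma> (c0 + c1 * a1 + c2 * a2)"
    using embedding_mult[OF emb x b] c(4) by simp
  also have "\<dots> = of_real c0 + of_real c1 * \<sigma> a1 + of_real c2 * \<sigma> a2"
    by (rule embedding_lincomb[OF cub emb c(1-3) Kset_gens])
  finally show ?thesis
    unfolding mult_mat_def c(4) kcoord_eq[OF cub c(1-3)] by simp
qed

lemma knorm_expand:
  "knorm a1 a2 x = (let m = mult_mat a1 a2 x in
     m 0 0 * m 1 1 * m 2 2 + m 0 1 * m 1 2 * m 2 0 + m 0 2 * m 1 0 * m 2 1
   - m 0 0 * m 1 2 * m 2 1 - m 0 1 * m 1 0 * m 2 2 - m 0 2 * m 1 1 * m 2 0)"
proof -
  have S: "{..<3::nat} = {0, 1, 2}" by auto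
  have f: "finite {1::nat, 2}" "(0::nat) \<notin> {1, 2}" "finite {2::nat}" "(1::nat) \<notin> {2}" by auto
  show ?thesis
    unfolding knorm_def S Let_def
    unfolding sum_over_permutations_insert[OF f(1,2)]
    unfolding sum_over_permutations_insert[OF f(3,4)]
    unfolding permutes_sing
    by (simp add: sign_swap_id permutation_swap_id sign_compose sign_id transpose_def algebra_simps)
qed

text \<open>Distinctness is required at \<open>a1\<close> alone, since \<open>a1\<close> generates
  K. The disjunction \<open>conj\<close> records the two signatures, so that everything before the
  density argument can be carried out once with complex values.\<close>

locale cubic_conjugates =
  fixes a1 a2 :: real and \<sigma> \<tau> :: "real \<Rightarrow> complex"
  assumes cub: "cubic_field_basis a1 a2"
    and emb: "complex_embedding a1 a2 \<sigma>" "complex_embedding a1 a2 \<tau>"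
    and distinct: "\<sigma> a1 \<noteq> of_real a1" "\<tau> a1 \<noteq> of_real a1" "\<sigma> a1 \<noteq> \<tau> a1"
    and conj: "(\<forall>x \<in> Kset a1 a2. \<sigma> x \<in> \<real> \<and> \<tau> x \<in> \<real>) \<or> (\<forall>x \<in> Kset a1 a2. \<tau> x = cnj (\<sigma> x))"
begin

abbreviation "K \<equiv> Kset a1 a2"
abbreviation "Tr \<equiv> ktrace a1 a2"
abbreviation "N \<equiv> knorm a1 a2"
abbreviation "D \<equiv> dual_lat a1 a2"

text \<open>The determinant of the matrix of conjugates of the basis 1, \<open>a1\<close>,
  \<open>a2\<close>, a square root of its discriminant.\<close>

definition disc_root :: complex where
  "disc_root = (of_real a1 - \<sigma> a1) * (of_real a2 - \<tau> a2) - (of_real a1 - \<tau> a1) * (of_real a2 - \<sigma> a2)"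

text \<open>Writing \<open>a2\<close> as a quadratic polynomial in \<open>a1\<close> with leading
  coefficient \<open>r2\<close> turns the determinant into \<open>r2\<close> times the Vandermonde
  product of the three conjugates of \<open>a1\<close>.\<close>

lemma disc_root_nonzero: "disc_root \<noteq> 0"
proof -
  obtain r0 r1 r2 where r: "r0 \<in> \<rat>" "r1 \<in> \<rat>" "r2 \<in> \<rat>" "r2 \<noteq> 0" "a2 = r0 + r1 * a1 + r2 * a1\<^sup>2"
    using cubic_primitive[OF cub] .
  have *: "\<rho> a2 = of_real r0 + of_real r1 * \<rho> a1 + of_real r2 * (\<rho> a1 * \<rho> a1)"
    if "complex_embedding a1 a2 \<rho>" for \<rho>
    using embedding_lincomb[OF cub that r(1-3) Kset_gens(1) cubic_mult[OF cub Kset_gens(1) Kset_gens(1)]]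
      embedding_mult[OF that Kset_gens(1) Kset_gens(1)] r(5) by (simp add: power2_eq_square)
  have "disc_root = of_real r2 * (of_real a1 - \<sigma> a1) * (of_real a1 - \<tau> a1) * (\<tau> a1 - \<sigma> a1)"
    unfolding disc_root_def *[OF emb(1)] *[OF emb(2)] *[OF embedding_of_real]
    by (simp add: algebra_simps)
  then show ?thesis using r(4) distinct by simp
qed

text \<open>The invertible matrix \<open>V\<close> of conjugates of the basis intertwines the
  multiplication matrix \<open>M\<close> with the diagonal matrix \<open>E\<close>, so the two have
  the same trace and determinant.\<close>

lemma trace_norm_conjugates:
  assumes x: "x \<in> K"
  shows "of_real (Tr x) = of_real x + \<sigma> x + \<tau> x" (is ?T)
    and "of_real (N x) = of_real x * \<sigma> x * \<tau> x" (is ?N)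
proof -
  define m where "m = mult_mat a1 a2 x"
  define M :: "complex^3^3" where
    "M = vector [vector [of_real (m 0 0), of_real (m 0 1), of_real (m 0 2)],
                 vector [of_real (m 1 0), of_real (m 1 1), of_real (m 1 2)],
                 vector [of_real (m 2 0), of_real (m 2 1), of_real (m 2 2)]]"
  define V :: "complex^3^3" where
    "V = vector [vector [1, of_real a1, of_real a2], vector [1, \<sigma> a1, \<sigma> a2], vector [1, \<tau> a1, \<tau> a2]]"
  define E :: "complex^3^3" where
    "E = vector [vector [of_real x, 0, 0], vector [0, \<sigma> x, 0], vector [0, 0, \<tau> x]]"
  have b: "kbasis a1 a2 0 = 1" "kbasis a1 a2 1 = a1" "kbasis a1 a2 2 = a2"
    by (simp_all add: kbasis_def)
  have one: "\<rho> 1 = 1" if "complex_embedding a1 a2 \<rho>" for \<rho>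
    using that unfolding complex_embedding_def by simp
  note eig = mult_mat_eigenvector[OF cub x, folded m_def, unfolded b]
  have VM: "V ** M = E ** V"
    using eig[OF emb(1), of 0] eig[OF emb(1), of 1] eig[OF emb(1), of 2]
      eig[OF emb(2), of 0] eig[OF emb(2), of 1] eig[OF emb(2), of 2]
      eig[OF embedding_of_real, of 0] eig[OF embedding_of_real, of 1] eig[OF embedding_of_real, of 2]
    unfolding b one[OF emb(1)] one[OF emb(2)]
    by (simp add: V_def M_def E_def vec_eq_iff forall_3 matrix_matrix_mult_def sum_3 algebra_simps)
  have "det V = disc_root"
    unfolding det_3 V_def disc_root_def by (simp add: algebra_simps)
  then have dV: "det V \<noteq> 0" using disc_root_nonzero by simp
  have "det V * det M = det E * det V" using VM det_mul by metis
  then have "det M = det E" using dV by simp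
  moreover have "det M = of_real (N x)"
    unfolding det_3 M_def knorm_expand m_def[symmetric] Let_def by simp
  moreover have "det E = of_real x * \<sigma> x * \<tau> x"
    unfolding det_3 E_def by simp
  ultimately show ?N by simp
  obtain W where W: "V ** W = mat 1" "W ** V = mat 1"
    using dV invertible_det_nz[of V] unfolding invertible_def by blast
  have "trace M = trace (W ** (V ** M))"
    by (simp add: matrix_mul_assoc W)
  also have "\<dots> = trace (W ** (E ** V))" using VM by simp
  also have "\<dots> = trace ((E ** V) ** W)" by (rule trace_mul_sym)
  also have "\<dots> = trace E" by (simp add: matrix_mul_assoc[symmetric] W)
  finally have "trace M = trace E" .
  moreover have "trace M = of_real (Tr x)"
    unfolding trace_def M_def ktrace_def m_def[symmetric] by (simp add: sum_3 numeral_3_eq_3 numeral_2_eq_2)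
  moreover have "trace E = of_real x + \<sigma> x + \<tau> x"
    unfolding trace_def E_def by (simp add: sum_3)
  ultimately show ?T by simp
qed

lemma trace_rat: "x \<in> K \<Longrightarrow> Tr x \<in> \<rat>"
  unfolding ktrace_def by (simp add: numeral_3_eq_3 mult_mat_rat[OF cub])

end

section \<open>The dual lattice\<close>

text \<open>Cramer's rule, written out in the entries so that the rationality of the solution can be
  read off the formulas.\<close>

lemma linear_system_3:
  fixes t00 t01 t02 t10 t11 t12 t20 t21 t22 n0 n1 n2 :: "'a::field"
  defines "d \<equiv> t00 * (t11 * t22 - t12 * t21) - t01 * (t10 * t22 - t12 * t20) + t02 * (t10 * t21 - t11 * t20)"
  assumes d: "d \<noteq> 0"
  defines "x0 \<equiv> (n0 * (t11 * t22 - t12 * t21) - t01 * (n1 * t22 - t12 * n2) + t02 * (n1 * t21 - t11 * n2)) / d"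
  defines "x1 \<equiv> (t00 * (n1 * t22 - t12 * n2) - n0 * (t10 * t22 - t12 * t20) + t02 * (t10 * n2 - n1 * t20)) / d"
  defines "x2 \<equiv> (t00 * (t11 * n2 - n1 * t21) - t01 * (t10 * n2 - n1 * t20) + n0 * (t10 * t21 - t11 * t20)) / d"
  shows "t00 * x0 + t01 * x1 + t02 * x2 = n0"
    and "t10 * x0 + t11 * x1 + t12 * x2 = n1"
    and "t20 * x0 + t21 * x1 + t22 * x2 = n2"
  unfolding x0_def x1_def x2_def times_divide_eq_right add_divide_distrib[symmetric] divide_eq_eq
  using d by (simp_all add: d_def algebra_simps)

lemma rat_clear_denom:
  fixes r :: real
  assumes "r \<in> \<rat>"
  obtains d :: int where "d > 0" "of_int d * r \<in> \<int>"
proof -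
  obtain a b where "b > 0" "r = real_of_int a / real_of_int b" by (rule Rats_cases'[OF assms])
  then show thesis using that[of b] by simp
qed

context cubic_conjugates begin

lemmas K_closed = Kset_add[of _ a1 a2] cubic_mult[OF cub] cubic_divide[OF cub] cubic_diff[OF cub]
  cubic_uminus[OF cub] Kset_gens(1)[of a1 a2] Kset_gens(2)[of a2 a1] Kset_rat[of _ a1 a2]

lemma trace_add: "x \<in> K \<Longrightarrow> y \<in> K \<Longrightarrow> Tr (x + y) = Tr x + Tr y"
proof -
  assume "x \<in> K" "y \<in> K"
  then have "complex_of_real (Tr (x + y)) = of_real (Tr x + Tr y)"
    by (simp add: trace_norm_conjugates K_closed embedding_add[OF emb(1)] embedding_add[OF emb(2)])
  then show ?thesis by (simp only: of_real_eq_iff)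
qed

lemma trace_scale: "r \<in> \<rat> \<Longrightarrow> x \<in> K \<Longrightarrow> Tr (r * x) = r * Tr x"
proof -
  assume "r \<in> \<rat>" "x \<in> K"
  then have "complex_of_real (Tr (r * x)) = of_real (r * Tr x)"
    by (simp add: trace_norm_conjugates K_closed embedding_mult[OF emb(1)] embedding_mult[OF emb(2)]
        embedding_rat[OF emb(1)] embedding_rat[OF emb(2)] algebra_simps)
  then show ?thesis by (simp only: of_real_eq_iff)
qed

lemma trace_lincomb:
  assumes "c0 \<in> \<rat>" "c1 \<in> \<rat>" "c2 \<in> \<rat>" "x \<in> K" "y \<in> K" "z \<in> K"
  shows "Tr (c0 * x + c1 * y + c2 * z) = c0 * Tr x + c1 * Tr y + c2 * Tr z"
  using assms by (simp add: trace_add trace_scale K_closed)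

lemma dual_iff: "x \<in> D \<longleftrightarrow> x \<in> K \<and> Tr x \<in> \<int> \<and> Tr (x * a1) \<in> \<int> \<and> Tr (x * a2) \<in> \<int>"
proof
  assume x: "x \<in> D"
  have "1 \<in> Lat a1 a2" "a1 \<in> Lat a1 a2" "a2 \<in> Lat a1 a2"
    unfolding Lat_def mem_Collect_eq
    by (rule exI[of _ 1], rule exI[of _ 0], rule exI[of _ 0], simp)
       (rule exI[of _ 0], rule exI[of _ 1], rule exI[of _ 0], simp,
        rule exI[of _ 0], rule exI[of _ 0], rule exI[of _ 1], simp)
  then have "Tr (x * 1) \<in> \<int>" "Tr (x * a1) \<in> \<int>" "Tr (x * a2) \<in> \<int>"
    using x unfolding dual_lat_def by blast+
  then show "x \<in> K \<and> Tr x \<in> \<int> \<and> Tr (x * a1) \<in> \<int> \<and> Tr (x * a2) \<in> \<int>"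
    using x unfolding dual_lat_def by simp
next
  assume x: "x \<in> K \<and> Tr x \<in> \<int> \<and> Tr (x * a1) \<in> \<int> \<and> Tr (x * a2) \<in> \<int>"
  have "Tr (x * y) \<in> \<int>" if yL: "y \<in> Lat a1 a2" for y
  proof -
    obtain m0 m1 m2 :: int where y: "y = of_int m0 + of_int m1 * a1 + of_int m2 * a2"
      using yL unfolding Lat_def by blast
    have "x * y = of_int m0 * x + of_int m1 * (x * a1) + of_int m2 * (x * a2)"
      unfolding y by (simp add: algebra_simps)
    then have "Tr (x * y) = of_int m0 * Tr x + of_int m1 * Tr (x * a1) + of_int m2 * Tr (x * a2)"
      using x by (simp add: trace_lincomb K_closed)
    then show ?thesis using x by simp
  qed
  then show "x \<in> D" using x unfolding dual_lat_def by blast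
qed

lemma dual_K: "x \<in> D \<Longrightarrow> x \<in> K"
  by (simp add: dual_iff)

lemma dual_add: "x \<in> D \<Longrightarrow> y \<in> D \<Longrightarrow> x + y \<in> D"
  by (simp add: dual_iff K_closed trace_add distrib_right)

lemma dual_int_mult: "x \<in> D \<Longrightarrow> of_int k * x \<in> D"
  by (simp add: dual_iff K_closed trace_scale mult.assoc)

lemma dual_uminus: "x \<in> D \<Longrightarrow> - x \<in> D"
  using dual_int_mult[of x "-1"] by simp

text \<open>When both traces are expanded, the inclusion contributes \<open>x * y - x * y\<close>
  and cancels. This is why the approximation errors see only the two other conjugates of
  \<open>x\<close>.\<close>

lemma trace_approx:
  assumes "x \<in> K" "y \<in> K"
  shows "of_real (Tr x * y - Tr (x * y)) = \<sigma> x * (of_real y - \<sigma> y) + \<tau> x * (of_real y - \<tau> y)"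
  using assms
  by (simp add: trace_norm_conjugates K_closed embedding_mult[OF emb(1)] embedding_mult[OF emb(2)] algebra_simps)

text \<open>Together with \<open>crdY\<close> this is Cramer's solution (X, Y) of the system v_i = X
  (a_i - \<sigma> a_i) + Y (a_i - \<tau> a_i), whose determinant is
  \<open>disc_root\<close>.\<close>

definition crdX :: "real \<times> real \<Rightarrow> complex" where
  "crdX v = ((of_real a2 - \<tau> a2) * of_real (fst v) - (of_real a1 - \<tau> a1) * of_real (snd v)) / disc_root"

definition crdY :: "real \<times> real \<Rightarrow> complex" where
  "crdY v = ((of_real a1 - \<sigma> a1) * of_real (snd v) - (of_real a2 - \<sigma> a2) * of_real (fst v)) / disc_root"

lemma crd_trace:
  assumes "x \<in> K"
  shows "crdX (Tr x * a1 - Tr (x * a1), Tr x * a2 - Tr (x * a2)) = \<sigma> x"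
    and "crdY (Tr x * a1 - Tr (x * a1), Tr x * a2 - Tr (x * a2)) = \<tau> x"
  unfolding crdX_def crdY_def fst_conv snd_conv
    trace_approx[OF assms Kset_gens(1)] trace_approx[OF assms Kset_gens(2)]
  using disc_root_nonzero by (simp_all add: divide_eq_eq) (simp_all add: disc_root_def algebra_simps)

text \<open>The three traces determine \<open>\<sigma> x\<close> through \<open>crdX\<close>, and an
  embedding of a field is injective.\<close>

lemma trace_inj:
  assumes "x \<in> K" "y \<in> K" "Tr x = Tr y" "Tr (x * a1) = Tr (y * a1)" "Tr (x * a2) = Tr (y * a2)"
  shows "x = y"
proof (rule ccontr)
  assume "x \<noteq> y"
  have "\<sigma> x = \<sigma> y" using crd_trace(1)[OF assms(1)] crd_trace(1)[OF assms(2)] assms(3-5) by simp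
  have "\<sigma> (x - y) = \<sigma> x - \<sigma> y"
    using embedding_add[OF emb(1) assms(1) cubic_uminus[OF cub assms(2)]]
      embedding_uminus[OF emb(1) assms(2)] by simp
  then show False
    using embedding_nonzero[OF cub emb(1) cubic_diff[OF cub assms(1,2)]] \<open>x \<noteq> y\<close> \<open>\<sigma> x = \<sigma> y\<close> by simp
qed

text \<open>Nondegeneracy of the trace form: the coordinates of \<open>x\<close> solve a rational
  system whose matrix is the Gram matrix of the basis. For integral right-hand sides the solution
  lies in the dual lattice, which turns integer triples into elements of D.\<close>

lemma trace_surj:
  assumes n: "n0 \<in> \<rat>" "n1 \<in> \<rat>" "n2 \<in> \<rat>"
  obtains x where "x \<in> K" "Tr x = n0" "Tr (x * a1) = n1" "Tr (x * a2) = n2"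
proof -
  define t00 t01 t02 t11 t12 t22 where t:
    "t00 = Tr 1" "t01 = Tr a1" "t02 = Tr a2" "t11 = Tr (a1 * a1)" "t12 = Tr (a1 * a2)" "t22 = Tr (a2 * a2)"
  have tQ: "t00 \<in> \<rat>" "t01 \<in> \<rat>" "t02 \<in> \<rat>" "t11 \<in> \<rat>" "t12 \<in> \<rat>" "t22 \<in> \<rat>"
    unfolding t by (simp_all add: trace_rat K_closed)
  define d where "d = t00 * (t11 * t22 - t12 * t12) - t01 * (t01 * t22 - t12 * t02) + t02 * (t01 * t12 - t11 * t02)"
  have one: "\<sigma> 1 = 1" "\<tau> 1 = 1" using emb unfolding complex_embedding_def by auto
  \<comment> \<open>the discriminant is the square of the determinant of the conjugates of the basis\<close>
  have "of_real d = disc_root * disc_root"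
    unfolding d_def t of_real_add of_real_diff of_real_mult disc_root_def
    by (simp add: trace_norm_conjugates K_closed embedding_mult[OF emb(1)] embedding_mult[OF emb(2)] one algebra_simps)
  then have d: "d \<noteq> 0" using disc_root_nonzero by auto
  define c0 c1 c2 where c:
    "c0 = (n0 * (t11 * t22 - t12 * t12) - t01 * (n1 * t22 - t12 * n2) + t02 * (n1 * t12 - t11 * n2)) / d"
    "c1 = (t00 * (n1 * t22 - t12 * n2) - n0 * (t01 * t22 - t12 * t02) + t02 * (t01 * n2 - n1 * t02)) / d"
    "c2 = (t00 * (t11 * n2 - n1 * t12) - t01 * (t01 * n2 - n1 * t02) + n0 * (t01 * t12 - t11 * t02)) / d"
  have sys: "t00 * c0 + t01 * c1 + t02 * c2 = n0" "t01 * c0 + t11 * c1 + t12 * c2 = n1"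
    "t02 * c0 + t12 * c1 + t22 * c2 = n2"
    unfolding c d_def by (rule linear_system_3[OF d[unfolded d_def]])+
  have "d \<in> \<rat>" unfolding d_def using tQ by simp
  then have cQ: "c0 \<in> \<rat>" "c1 \<in> \<rat>" "c2 \<in> \<rat>" unfolding c using tQ n by simp_all
  define x where "x = c0 + c1 * a1 + c2 * a2"
  show thesis
  proof (rule that[of x])
    show "x \<in> K" unfolding x_def by (intro KsetI cQ)
    have "Tr x = Tr (c0 * 1 + c1 * a1 + c2 * a2)" unfolding x_def by simp
    also have "\<dots> = n0"
      unfolding trace_lincomb[OF cQ Kset_rat[OF Rats_1] Kset_gens] t[symmetric] using sys(1) by (simp add: mult.commute)
    finally show "Tr x = n0" .
    have "Tr (x * a1) = Tr (c0 * a1 + c1 * (a1 * a1) + c2 * (a1 * a2))"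
      unfolding x_def by (simp add: algebra_simps)
    also have "\<dots> = c0 * t01 + c1 * t11 + c2 * t12"
      unfolding t by (intro trace_lincomb cQ K_closed)
    finally show "Tr (x * a1) = n1" using sys(2) by (simp add: mult.commute)
    have "Tr (x * a2) = Tr (c0 * a2 + c1 * (a1 * a2) + c2 * (a2 * a2))"
      unfolding x_def by (simp add: algebra_simps)
    also have "\<dots> = c0 * t02 + c1 * t12 + c2 * t22"
      unfolding t by (intro trace_lincomb cQ K_closed)
    finally show "Tr (x * a2) = n2" using sys(3) by (simp add: mult.commute)
  qed
qed

lemma dual_basis:
  obtains e0 e1 e2 where "e0 \<in> D" "e1 \<in> D" "e2 \<in> D"
    "\<And>s. s \<in> D \<Longrightarrow> s = Tr s * e0 + Tr (s * a1) * e1 + Tr (s * a2) * e2"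
proof -
  obtain e0 where e0: "e0 \<in> K" "Tr e0 = 1" "Tr (e0 * a1) = 0" "Tr (e0 * a2) = 0"
    by (rule trace_surj[of 1 0 0]) auto
  obtain e1 where e1: "e1 \<in> K" "Tr e1 = 0" "Tr (e1 * a1) = 1" "Tr (e1 * a2) = 0"
    by (rule trace_surj[of 0 1 0]) auto
  obtain e2 where e2: "e2 \<in> K" "Tr e2 = 0" "Tr (e2 * a1) = 0" "Tr (e2 * a2) = 1"
    by (rule trace_surj[of 0 0 1]) auto
  show thesis
  proof (rule that[of e0 e1 e2])
    fix s assume "s \<in> D"
    then have s: "s \<in> K" "Tr s \<in> \<rat>" "Tr (s * a1) \<in> \<rat>" "Tr (s * a2) \<in> \<rat>"
      by (auto simp: dual_iff trace_rat K_closed)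
    define y where "y = Tr s * e0 + Tr (s * a1) * e1 + Tr (s * a2) * e2"
    have m: "y * b = Tr s * (e0 * b) + Tr (s * a1) * (e1 * b) + Tr (s * a2) * (e2 * b)" for b
      unfolding y_def by (simp add: algebra_simps)
    have "y \<in> K" unfolding y_def by (intro K_closed s e0 e1 e2)
    moreover have "Tr y = Tr s"
      unfolding y_def using trace_lincomb[OF s(2-4) e0(1) e1(1) e2(1)] e0 e1 e2 by simp
    moreover have "Tr (y * a1) = Tr (s * a1)" "Tr (y * a2) = Tr (s * a2)"
      unfolding m using e0 e1 e2 s by (simp_all add: trace_lincomb K_closed)
    ultimately show "s = Tr s * e0 + Tr (s * a1) * e1 + Tr (s * a2) * e2"
      using trace_inj[of y s] s(1) unfolding y_def by simp
  qed (use e0 e1 e2 in \<open>auto simp: dual_iff\<close>)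
qed

section \<open>Bounded denominators of products, cofactors and norms\<close>

lemma dual_clear_denom:
  assumes x: "x \<in> K"
  obtains d :: int where "d > 0" "of_int d * x \<in> D"
proof -
  obtain d0 where d0: "d0 > 0" "real_of_int d0 * Tr x \<in> \<int>"
    by (rule rat_clear_denom[of "Tr x"]) (auto simp: trace_rat K_closed x)
  obtain d1 where d1: "d1 > 0" "real_of_int d1 * Tr (x * a1) \<in> \<int>"
    by (rule rat_clear_denom[of "Tr (x * a1)"]) (auto simp: trace_rat K_closed x)
  obtain d2 where d2: "d2 > 0" "real_of_int d2 * Tr (x * a2) \<in> \<int>"
    by (rule rat_clear_denom[of "Tr (x * a2)"]) (auto simp: trace_rat K_closed x)
  have tr: "Tr (of_int (d0 * d1 * d2) * z) = of_int (d0 * d1 * d2) * Tr z" if "z \<in> K" for z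
    by (rule trace_scale) (use that in auto)
  have "of_int (d0 * d1 * d2) * Tr x = of_int (d1 * d2) * (of_int d0 * Tr x)"
    "of_int (d0 * d1 * d2) * Tr (x * a1) = of_int (d0 * d2) * (of_int d1 * Tr (x * a1))"
    "of_int (d0 * d1 * d2) * Tr (x * a2) = of_int (d0 * d1) * (of_int d2 * Tr (x * a2))"
    by simp_all
  then have "of_int (d0 * d1 * d2) * Tr x \<in> \<int>" "of_int (d0 * d1 * d2) * Tr (x * a1) \<in> \<int>"
    "of_int (d0 * d1 * d2) * Tr (x * a2) \<in> \<int>"
    using d0(2) d1(2) d2(2) by (metis Ints_mult Ints_of_int)+
  then have "of_int (d0 * d1 * d2) * x \<in> D"
    unfolding dual_iff mult.assoc[of _ x] using x by (simp only: tr K_closed) (simp add: K_closed)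
  then show thesis using that[of "d0 * d1 * d2"] d0 d1 d2 by simp
qed

lemma dual_lincomb_int:
  assumes "c0 \<in> \<int>" "c1 \<in> \<int>" "c2 \<in> \<int>" "x \<in> D" "y \<in> D" "z \<in> D"
  shows "c0 * x + c1 * y + c2 * z \<in> D"
  using assms by (auto elim!: Ints_cases intro!: dual_add dual_int_mult)

text \<open>D is generated by three elements, so denominators found for each of them multiply to one
  that serves all of D. The second factor ranges over an arbitrary set \<open>A\<close> because the
  lemma is applied once for each factor of a product: with \<open>A\<close> a singleton, and then
  with \<open>A\<close> equal to D.\<close>

lemma dual_common_denom:
  assumes P: "\<And>e. e \<in> D \<Longrightarrow> \<exists>d>0. \<forall>t\<in>A. of_int d * (e * t) \<in> D"
  shows "\<exists>d::int. d > 0 \<and> (\<forall>s\<in>D. \<forall>t\<in>A. of_int d * (s * t) \<in> D)"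
proof -
  obtain e0 e1 e2 where e: "e0 \<in> D" "e1 \<in> D" "e2 \<in> D"
    and ex: "\<And>s. s \<in> D \<Longrightarrow> s = Tr s * e0 + Tr (s * a1) * e1 + Tr (s * a2) * e2"
    using dual_basis by blast
  obtain d0 :: int where d0: "d0 > 0" "\<forall>t\<in>A. of_int d0 * (e0 * t) \<in> D" using P[OF e(1)] by blast
  obtain d1 :: int where d1: "d1 > 0" "\<forall>t\<in>A. of_int d1 * (e1 * t) \<in> D" using P[OF e(2)] by blast
  obtain d2 :: int where d2: "d2 > 0" "\<forall>t\<in>A. of_int d2 * (e2 * t) \<in> D" using P[OF e(3)] by blast
  have "of_int (d0 * d1 * d2) * (s * t) \<in> D" if "s \<in> D" "t \<in> A" for s t
  proof -
    have Z: "Tr s \<in> \<int>" "Tr (s * a1) \<in> \<int>" "Tr (s * a2) \<in> \<int>" using that dual_iff by auto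
    have "of_int (d0 * d1 * d2) * (s * t) =
        of_int (d0 * d1 * d2) * ((Tr s * e0 + Tr (s * a1) * e1 + Tr (s * a2) * e2) * t)"
      using ex[OF that(1)] by simp
    also have "\<dots> = (of_int (d1 * d2) * Tr s) * (of_int d0 * (e0 * t))
        + (of_int (d0 * d2) * Tr (s * a1)) * (of_int d1 * (e1 * t))
        + (of_int (d0 * d1) * Tr (s * a2)) * (of_int d2 * (e2 * t))"
      by (simp add: algebra_simps)
    also have "\<dots> \<in> D"
      using Z d0 d1 d2 that by (intro dual_lincomb_int Ints_mult Ints_of_int) auto
    finally show ?thesis .
  qed
  then show ?thesis using d0 d1 d2 by (intro exI[of _ "d0 * d1 * d2"]) auto
qed

lemma dual_mult_denom: "\<exists>d::int. d > 0 \<and> (\<forall>s\<in>D. \<forall>t\<in>D. of_int d * (s * t) \<in> D)"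
proof (rule dual_common_denom)
  fix e assume e: "e \<in> D"
  have "\<exists>d::int. d > 0 \<and> (\<forall>s\<in>D. \<forall>t\<in>{e}. of_int d * (s * t) \<in> D)"
  proof (rule dual_common_denom)
    fix f assume "f \<in> D"
    then show "\<exists>d::int>0. \<forall>t\<in>{e}. of_int d * (f * t) \<in> D"
      using dual_clear_denom[of "f * e"] e by (metis dual_K cubic_mult[OF cub] singletonD)
  qed
  then show "\<exists>d::int>0. \<forall>t\<in>D. of_int d * (e * t) \<in> D"
    by (auto simp: mult.commute)
qed

text \<open>The bracket is the product \<open>\<sigma> x * \<tau> x\<close> expressed inside K: it
  equals e2 - \<open>x\<close> (\<open>\<sigma> x + \<tau> x\<close>), where e2 is the second
  elementary symmetric function of the conjugates. Newton's identity gives e2 from the traces of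
  \<open>x\<close> and \<open>x * x\<close>, and \<open>\<sigma> x + \<tau> x\<close> is
  \<open>Tr x - x\<close>.\<close>

lemma norm_cofactor:
  assumes "x \<in> K"
  shows "N x = x * (x * x - Tr x * x + ((Tr x)\<^sup>2 - Tr (x * x)) / 2)"
proof -
  have "complex_of_real (N x) = of_real (x * (x * x - Tr x * x + ((Tr x)\<^sup>2 - Tr (x * x)) / 2))"
    using assms by (simp add: trace_norm_conjugates K_closed embedding_mult[OF emb(1)]
        embedding_mult[OF emb(2)] field_simps power2_eq_square)
  then show ?thesis by (simp only: of_real_eq_iff)
qed

lemma norm_nonzero: "x \<in> K \<Longrightarrow> x \<noteq> 0 \<Longrightarrow> N x \<noteq> 0"
  using trace_norm_conjugates(2)[of x] embedding_nonzero[OF cub emb(1)] embedding_nonzero[OF cub emb(2)] by auto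

text \<open>The cofactor is a quadratic polynomial in \<open>s\<close> whose coefficients are
  traces, so its denominator is bounded. It later replaces division by \<open>s\<close> by division
  by \<open>N s\<close>, which can be pinned to one value by the pigeonhole principle.\<close>

lemma dual_cofactor_denom: "\<exists>d::int. d > 0 \<and> (\<forall>s\<in>D. s \<noteq> 0 \<longrightarrow> of_int d * (N s / s) \<in> D)"
proof -
  obtain d :: int where d: "d > 0" "\<forall>s\<in>D. \<forall>t\<in>D. of_int d * (s * t) \<in> D"
    using dual_mult_denom by blast
  obtain d1 :: int where d1: "d1 > 0" "of_int d1 * 1 \<in> D"
    by (rule dual_clear_denom[of 1]) (auto simp: K_closed)
  \<comment> \<open>The 2 clears the half in Newton's identity, \<open>d\<close> puts
    \<open>s * s\<close> into D and makes its trace integral, and \<open>d1\<close> carries the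
    remaining constant term into D.\<close>
  have "of_int (2 * d * d1) * (N s / s) \<in> D" if s: "s \<in> D" "s \<noteq> 0" for s
  proof -
    have sK: "s \<in> K" using s dual_K by simp
    have "N s / s = s * s - Tr s * s + ((Tr s)\<^sup>2 - Tr (s * s)) / 2"
      using norm_cofactor[OF sK] s(2) by simp
    moreover have "Tr (of_int d * (s * s)) = of_int d * Tr (s * s)"
      by (simp add: trace_scale sK K_closed)
    ultimately have "of_int (2 * d * d1) * (N s / s) =
      of_int (2 * d1) * (of_int d * (s * s)) + (of_int (2 * d * d1) * (- Tr s)) * s
       + (of_int d * (Tr s)\<^sup>2 - Tr (of_int d * (s * s))) * (of_int d1 * 1)"
      by (simp only:) (simp add: field_simps)
    also have "\<dots> \<in> D"
      using s d d1 dual_iff[of s] dual_iff[of "of_int d * (s * s)"]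
      by (intro dual_lincomb_int) auto
    finally show ?thesis .
  qed
  then show ?thesis using d d1 by (intro exI[of _ "2 * d * d1"]) auto
qed

lemma norm_denom: "\<exists>d::int. d > 0 \<and> (\<forall>s\<in>D. of_int d * N s \<in> \<int>)"
proof -
  obtain d :: int where d: "d > 0" "\<forall>s\<in>D. \<forall>t\<in>D. of_int d * (s * t) \<in> D"
    using dual_mult_denom by blast
  obtain d1 :: int where d1: "d1 > 0" "\<forall>s\<in>D. s \<noteq> 0 \<longrightarrow> of_int d1 * (N s / s) \<in> D"
    using dual_cofactor_denom by blast
  have tr1: "Tr 1 = 3"
    using trace_norm_conjugates(1)[of 1] emb unfolding complex_embedding_def
    by (simp add: K_closed flip: of_real_eq_iff[where 'a=complex])
  \<comment> \<open>The multiple of \<open>N s\<close> by \<open>d * d1\<close> lies in D, being a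
    cleared product of \<open>s\<close> with its cofactor. Integrality is then read off its trace,
    and the trace of a rational number is three times that number.\<close>
  have "of_int (3 * d * d1) * N s \<in> \<int>" if s: "s \<in> D" for s
  proof (cases "s = 0")
    case True
    then show ?thesis using norm_cofactor[of 0] K_closed by simp
  next
    case False
    have "of_int d * (s * (of_int d1 * (N s / s))) \<in> D" using d d1 s False by blast
    also have "of_int d * (s * (of_int d1 * (N s / s))) = (of_int (d * d1) * N s) * 1"
      using False by simp
    finally have "Tr ((of_int (d * d1) * N s) * 1) \<in> \<int>" by (simp only: dual_iff)
    moreover have "N s \<in> \<rat>"
      using s dual_K[OF s] mult_mat_rat[OF cub] unfolding knorm_expand Let_def by simp
    ultimately show ?thesis
      using trace_scale[of "of_int (d * d1) * N s" 1] tr1 by (simp add: K_closed mult_ac)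
  qed
  then show ?thesis using d d1 by (intro exI[of _ "3 * d * d1"]) auto
qed

end

section \<open>Accumulation points and the conjugate coordinates\<close>

definition approx_pt :: "real \<Rightarrow> real \<Rightarrow> int \<Rightarrow> int \<Rightarrow> int \<Rightarrow> real \<times> real" where
  "approx_pt a1 a2 q p1 p2 = (sqrt \<bar>real_of_int q\<bar> * (of_int q * a1 - of_int p1),
                              sqrt \<bar>real_of_int q\<bar> * (of_int q * a2 - of_int p2))"

lemma approx_set_eq: "approx_set a1 a2 = {approx_pt a1 a2 q p1 p2 | q p1 p2. q \<noteq> 0}"
  unfolding approx_set_def approx_pt_def ..

text \<open>Squaring the first coordinates gives a rational relation between 1, \<open>a1\<close>
  and \<open>a1\<^sup>2\<close> whose leading coefficient is the difference of the cubes of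
  \<open>\<bar>q\<bar>\<close> and \<open>\<bar>q'\<bar>\<close>. It ensures that approximations of
  different height are different points.\<close>

lemma approx_pt_inj:
  assumes cub: "cubic_field_basis a1 a2"
    and eq: "approx_pt a1 a2 q p1 p2 = approx_pt a1 a2 q' p1' p2'"
  shows "\<bar>q\<bar> = \<bar>q'\<bar>"
proof -
  define A B where "A = real_of_int \<bar>q\<bar>" and "B = real_of_int \<bar>q'\<bar>"
  have sq: "(sqrt \<bar>real_of_int q\<bar> * (of_int q * a1 - of_int p1))\<^sup>2 = (sqrt \<bar>real_of_int q'\<bar> * (of_int q' * a1 - of_int p1'))\<^sup>2"
    using eq unfolding approx_pt_def by simp
  have "A * (of_int q * a1 - of_int p1)\<^sup>2 = B * (of_int q' * a1 - of_int p1')\<^sup>2"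
    using sq unfolding power_mult_distrib A_def B_def by simp
  then have eq0: "(A * of_int p1 ^ 2 - B * of_int p1' ^ 2) + (2 * B * of_int q' * of_int p1' - 2 * A * of_int q * of_int p1) * a1
      + (A * of_int q ^ 2 - B * of_int q' ^ 2) * a1\<^sup>2 = 0"
    by (simp add: power2_eq_square algebra_simps)
  have AB: "A \<in> \<rat>" "B \<in> \<rat>" unfolding A_def B_def by auto
  have "A * of_int q ^ 2 - B * of_int q' ^ 2 = 0"
    by (rule cubic_indep(3)[OF cubic_power_basis(1)[OF cub] _ _ _ eq0]) (simp_all add: AB)
  moreover have "A * of_int q ^ 2 = A ^ 3" "B * of_int q' ^ 2 = B ^ 3"
    unfolding A_def B_def by (simp_all add: power3_eq_cube power2_eq_square mult.assoc abs_mult_self_eq)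
  ultimately have "A ^ 3 = B ^ 3" by simp
  moreover have "A \<ge> 0" "B \<ge> 0" unfolding A_def B_def by auto
  ultimately have "A = B" using power_eq_imp_eq_base[of A 3 B] by simp
  then show ?thesis unfolding A_def B_def by simp
qed

text \<open>A ball contains only finitely many approximation points of bounded \<open>q\<close>, so
  an accumulation point needs unbounded \<open>q\<close>. Conversely, two nearby approximations with
  different \<open>\<bar>q\<bar>\<close> cannot both equal \<open>v\<close>, so a limit point in the
  punctured sense results.\<close>

lemma A_half_iff:
  assumes cub: "cubic_field_basis a1 a2"
  shows "v \<in> A_half a1 a2 \<longleftrightarrow>
    (\<forall>e>0. \<forall>M::real. \<exists>q p1 p2. M < \<bar>real_of_int q\<bar> \<and> q \<noteq> 0 \<and> dist (approx_pt a1 a2 q p1 p2) v < e)"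
    (is "_ \<longleftrightarrow> ?R")
proof
  assume "v \<in> A_half a1 a2"
  then have inf: "infinite (approx_set a1 a2 \<inter> ball v e)" if "e > 0" for e
    using that unfolding A_half_def islimpt_eq_infinite_ball by simp
  show ?R
  proof (intro allI impI, rule ccontr)
    fix e M :: real assume e: "e > 0"
      and no: "\<not> (\<exists>q p1 p2. M < \<bar>real_of_int q\<bar> \<and> q \<noteq> 0 \<and> dist (approx_pt a1 a2 q p1 p2) v < e)"
    define B where "B = norm v + e"
    \<comment> \<open>Since \<open>q\<close> is a nonzero integer, its square root factor is at
      least 1, so the bound \<open>B\<close> for points of the ball also bounds the unweighted
      errors. With \<open>q\<close> bounded by \<open>M\<close> this confines \<open>p1\<close> and
      \<open>p2\<close>.\<close>
    define R1 R2 where "R1 = \<lceil>\<bar>M\<bar> * \<bar>a1\<bar> + B\<rceil>" and "R2 = \<lceil>\<bar>M\<bar> * \<bar>a2\<bar> + B\<rceil>"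
    have "approx_set a1 a2 \<inter> ball v e \<subseteq>
        (\<lambda>(q, p1, p2). approx_pt a1 a2 q p1 p2) ` ({- \<lceil>\<bar>M\<bar>\<rceil>..\<lceil>\<bar>M\<bar>\<rceil>} \<times> {- R1..R1} \<times> {- R2..R2})"
    proof
      fix w assume w: "w \<in> approx_set a1 a2 \<inter> ball v e"
      then obtain q p1 p2 where q: "q \<noteq> 0" "w = approx_pt a1 a2 q p1 p2"
        unfolding approx_set_eq by blast
      have dw: "dist w v < e" using w by (simp add: dist_commute)
      then have M: "\<bar>real_of_int q\<bar> \<le> M" using no q by force
      have nw: "norm w \<le> B"
        using dw norm_triangle_ineq2[of w v] unfolding B_def dist_norm by simp
      have bound: "\<bar>of_int p\<bar> \<le> \<bar>M\<bar> * \<bar>a\<bar> + B"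
        if b: "\<bar>sqrt \<bar>real_of_int q\<bar> * (of_int q * a - of_int p)\<bar> \<le> B" for a and p :: int
      proof -
        have "1 \<le> sqrt \<bar>real_of_int q\<bar>" using q(1) by simp
        then have "1 * \<bar>of_int q * a - of_int p\<bar> \<le> sqrt \<bar>real_of_int q\<bar> * \<bar>of_int q * a - of_int p\<bar>"
          by (intro mult_right_mono) auto
        then have "\<bar>of_int q * a - of_int p\<bar> \<le> B" using b by (simp add: abs_mult)
        moreover have "\<bar>of_int q * a\<bar> \<le> \<bar>M\<bar> * \<bar>a\<bar>"
          unfolding abs_mult using M by (intro mult_right_mono) auto
        ultimately show ?thesis by linarith
      qed
      have "\<bar>fst w\<bar> \<le> B" "\<bar>snd w\<bar> \<le> B"
        using nw norm_fst_le[of "fst w" "snd w"] norm_snd_le[of "snd w" "fst w"] by simp_all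
      then have "\<bar>real_of_int p1\<bar> \<le> \<bar>M\<bar> * \<bar>a1\<bar> + B" "\<bar>real_of_int p2\<bar> \<le> \<bar>M\<bar> * \<bar>a2\<bar> + B"
        using bound unfolding q(2) approx_pt_def by simp_all
      then have "q \<in> {- \<lceil>\<bar>M\<bar>\<rceil>..\<lceil>\<bar>M\<bar>\<rceil>}" "p1 \<in> {- R1..R1}" "p2 \<in> {- R2..R2}"
        using M unfolding R1_def R2_def by (simp_all, linarith+)
      then show "w \<in> (\<lambda>(q, p1, p2). approx_pt a1 a2 q p1 p2) ` ({- \<lceil>\<bar>M\<bar>\<rceil>..\<lceil>\<bar>M\<bar>\<rceil>} \<times> {- R1..R1} \<times> {- R2..R2})"
        unfolding q(2) by (intro image_eqI[of _ _ "(q, p1, p2)"]) auto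
    qed
    then have "finite (approx_set a1 a2 \<inter> ball v e)" by (rule finite_subset) auto
    then show False using inf[OF e] by simp
  qed
next
  assume R: ?R
  show "v \<in> A_half a1 a2"
    unfolding A_half_def mem_Collect_eq islimpt_approachable
  proof (intro allI impI)
    fix e :: real assume e: "e > 0"
    obtain q p1 p2 where q: "q \<noteq> 0" "dist (approx_pt a1 a2 q p1 p2) v < e"
      using R e by blast
    obtain q' p1' p2' where q': "\<bar>real_of_int q\<bar> < \<bar>real_of_int q'\<bar>" "q' \<noteq> 0" "dist (approx_pt a1 a2 q' p1' p2') v < e"
      using R e by blast
    have "approx_pt a1 a2 q p1 p2 \<noteq> approx_pt a1 a2 q' p1' p2'"
    proof
      assume "approx_pt a1 a2 q p1 p2 = approx_pt a1 a2 q' p1' p2'"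
      then have "\<bar>q\<bar> = \<bar>q'\<bar>" by (rule approx_pt_inj[OF cub])
      then show False using q'(1) by linarith
    qed
    moreover have "approx_pt a1 a2 q p1 p2 \<in> approx_set a1 a2" "approx_pt a1 a2 q' p1' p2' \<in> approx_set a1 a2"
      using q(1) q'(2) unfolding approx_set_eq by blast+
    ultimately show "\<exists>x'\<in>approx_set a1 a2. x' \<noteq> v \<and> dist x' v < e"
      using q(2) q'(3) by metis
  qed
qed

text \<open>Convergence of the weighted sequences while the weight tends to infinity forces
  \<open>x\<close> and \<open>y\<close> to 0, hence \<open>w - u\<close> to 0 and
  \<open>w / u\<close> to 1, so the weights may be exchanged. It is used in both directions, with
  the trace and the element itself in either role.\<close>

lemma rescale_by_asymptotic:
  fixes u w :: "nat \<Rightarrow> real" and x y :: "nat \<Rightarrow> complex"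
  assumes u: "filterlim (\<lambda>k. \<bar>u k\<bar>) at_top sequentially"
    and x: "(\<lambda>k. of_real (sqrt \<bar>u k\<bar>) * x k) \<longlonglongrightarrow> X"
    and y: "(\<lambda>k. of_real (sqrt \<bar>u k\<bar>) * y k) \<longlonglongrightarrow> Y"
    and d: "\<And>k. \<bar>w k - u k\<bar> \<le> norm (x k) + norm (y k)"
  shows "filterlim (\<lambda>k. \<bar>w k\<bar>) at_top sequentially"
    and "(\<lambda>k. of_real (sqrt \<bar>w k\<bar>) * x k) \<longlonglongrightarrow> X"
    and "(\<lambda>k. of_real (sqrt \<bar>w k\<bar>) * y k) \<longlonglongrightarrow> Y"
proof -
  have nz: "eventually (\<lambda>k. u k \<noteq> 0) sequentially"
    using filterlim_at_top_dense[THEN iffD1, OF u, rule_format, of 0] by (auto elim: eventually_mono)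
  have "filterlim (\<lambda>k. sqrt \<bar>u k\<bar>) at_top sequentially"
    using filterlim_compose[OF sqrt_at_top u] .
  then have i: "(\<lambda>k. complex_of_real (inverse (sqrt \<bar>u k\<bar>))) \<longlonglongrightarrow> of_real 0"
    by (intro tendsto_of_real tendsto_inverse_0_at_top)
  have small: "z \<longlonglongrightarrow> 0" if "(\<lambda>k. of_real (sqrt \<bar>u k\<bar>) * z k) \<longlonglongrightarrow> Z" for z :: "nat \<Rightarrow> complex" and Z
  proof -
    have "(\<lambda>k. (of_real (sqrt \<bar>u k\<bar>) * z k) * of_real (inverse (sqrt \<bar>u k\<bar>))) \<longlonglongrightarrow> 0"
      using tendsto_mult[OF that i] by simp
    moreover have "eventually (\<lambda>k. (of_real (sqrt \<bar>u k\<bar>) * z k) * of_real (inverse (sqrt \<bar>u k\<bar>)) = z k) sequentially"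
      using nz by eventually_elim (simp add: field_simps)
    ultimately show ?thesis by (rule Lim_transform_eventually)
  qed
  have "(\<lambda>k. norm (x k) + norm (y k)) \<longlonglongrightarrow> 0"
    using tendsto_add[OF tendsto_norm_zero[OF small[OF x]] tendsto_norm_zero[OF small[OF y]]] by simp
  then have wu: "(\<lambda>k. w k - u k) \<longlonglongrightarrow> 0"
    by (rule Lim_null_comparison[rotated]) (use d in \<open>auto intro: always_eventually\<close>)
  have "(\<lambda>k. \<bar>(w k - u k) * inverse \<bar>u k\<bar>\<bar>) \<longlonglongrightarrow> \<bar>0 * 0\<bar>"
    by (intro tendsto_rabs tendsto_mult wu tendsto_inverse_0_at_top u)
  then have "(\<lambda>k. (w k - u k) / u k) \<longlonglongrightarrow> 0"
    by (simp add: tendsto_rabs_zero_iff divide_inverse abs_mult tendsto_rabs_zero_cancel)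
  then have "(\<lambda>k. 1 + (w k - u k) / u k) \<longlonglongrightarrow> 1 + 0" by (intro tendsto_intros)
  moreover have "eventually (\<lambda>k. 1 + (w k - u k) / u k = w k / u k) sequentially"
    using nz by eventually_elim (simp add: field_simps)
  ultimately have "(\<lambda>k. w k / u k) \<longlonglongrightarrow> 1" by (simp add: Lim_transform_eventually)
  then have r: "(\<lambda>k. \<bar>w k / u k\<bar>) \<longlonglongrightarrow> 1" using tendsto_rabs by fastforce
  have "filterlim (\<lambda>k. \<bar>w k / u k\<bar> * \<bar>u k\<bar>) at_top sequentially"
    by (rule filterlim_tendsto_pos_mult_at_top[OF r _ u]) simp
  moreover have "eventually (\<lambda>k. \<bar>w k / u k\<bar> * \<bar>u k\<bar> = \<bar>w k\<bar>) sequentially"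
    using nz by eventually_elim (simp add: abs_divide)
  ultimately show "filterlim (\<lambda>k. \<bar>w k\<bar>) at_top sequentially"
    by (simp cong: filterlim_cong)
  have sr: "(\<lambda>k. complex_of_real (sqrt \<bar>w k / u k\<bar>)) \<longlonglongrightarrow> of_real (sqrt 1)"
    by (intro tendsto_of_real tendsto_real_sqrt r)
  have main: "(\<lambda>k. of_real (sqrt \<bar>w k\<bar>) * z k) \<longlonglongrightarrow> Z"
    if "(\<lambda>k. of_real (sqrt \<bar>u k\<bar>) * z k) \<longlonglongrightarrow> Z" for z :: "nat \<Rightarrow> complex" and Z
  proof -
    have "(\<lambda>k. of_real (sqrt \<bar>w k / u k\<bar>) * (of_real (sqrt \<bar>u k\<bar>) * z k)) \<longlonglongrightarrow> Z"
      using tendsto_mult[OF sr that] by simp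
    moreover have "eventually (\<lambda>k. of_real (sqrt \<bar>w k / u k\<bar>) * (of_real (sqrt \<bar>u k\<bar>) * z k) = of_real (sqrt \<bar>w k\<bar>) * z k) sequentially"
      using nz by eventually_elim (simp add: abs_divide real_sqrt_divide)
    ultimately show ?thesis by (rule Lim_transform_eventually)
  qed
  show "(\<lambda>k. of_real (sqrt \<bar>w k\<bar>) * x k) \<longlonglongrightarrow> X" "(\<lambda>k. of_real (sqrt \<bar>w k\<bar>) * y k) \<longlonglongrightarrow> Y"
    by (intro main x y)+
qed

context cubic_conjugates begin

lemma crd_scale: "crdX (c *\<^sub>R v) = of_real c * crdX v" "crdY (c *\<^sub>R v) = of_real c * crdY v"
  unfolding crdX_def crdY_def by (simp_all add: field_simps diff_divide_distrib)

lemma crd_recover: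
  "of_real (fst v) = crdX v * (of_real a1 - \<sigma> a1) + crdY v * (of_real a1 - \<tau> a1)"
  "of_real (snd v) = crdX v * (of_real a2 - \<sigma> a2) + crdY v * (of_real a2 - \<tau> a2)"
proof -
  have "disc_root * of_real (fst v) = disc_root * (crdX v * (of_real a1 - \<sigma> a1) + crdY v * (of_real a1 - \<tau> a1))"
    "disc_root * of_real (snd v) = disc_root * (crdX v * (of_real a2 - \<sigma> a2) + crdY v * (of_real a2 - \<tau> a2))"
    using disc_root_nonzero unfolding crdX_def crdY_def
    by (simp_all add: distrib_left) (simp_all add: disc_root_def algebra_simps)
  then show "of_real (fst v) = crdX v * (of_real a1 - \<sigma> a1) + crdY v * (of_real a1 - \<tau> a1)"
    "of_real (snd v) = crdX v * (of_real a2 - \<sigma> a2) + crdY v * (of_real a2 - \<tau> a2)"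
    using disc_root_nonzero by (metis mult_left_cancel)+
qed

lemma dual_of_ints:
  obtains x where "x \<in> D" "Tr x = of_int q" "Tr (x * a1) = of_int p1" "Tr (x * a2) = of_int p2"
  by (rule trace_surj[of "of_int q" "of_int p1" "of_int p2"]) (auto simp: dual_iff)

lemma crd_approx_pt:
  assumes "x \<in> K" "Tr x = of_int q" "Tr (x * a1) = of_int p1" "Tr (x * a2) = of_int p2"
  shows "crdX (approx_pt a1 a2 q p1 p2) = of_real (sqrt \<bar>Tr x\<bar>) * \<sigma> x"
    "crdY (approx_pt a1 a2 q p1 p2) = of_real (sqrt \<bar>Tr x\<bar>) * \<tau> x"
proof -
  have "approx_pt a1 a2 q p1 p2 = sqrt \<bar>Tr x\<bar> *\<^sub>R (Tr x * a1 - Tr (x * a1), Tr x * a2 - Tr (x * a2))"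
    unfolding approx_pt_def assms by simp
  then show "crdX (approx_pt a1 a2 q p1 p2) = of_real (sqrt \<bar>Tr x\<bar>) * \<sigma> x"
    "crdY (approx_pt a1 a2 q p1 p2) = of_real (sqrt \<bar>Tr x\<bar>) * \<tau> x"
    by (simp_all only: crd_scale crd_trace[OF assms(1)])
qed

lemma trace_near:
  assumes "x \<in> K"
  shows "\<bar>x - Tr x\<bar> \<le> norm (\<sigma> x) + norm (\<tau> x)" "\<bar>Tr x - x\<bar> \<le> norm (\<sigma> x) + norm (\<tau> x)"
proof -
  have "norm (complex_of_real (Tr x - x)) = norm (\<sigma> x + \<tau> x)"
    using trace_norm_conjugates(1)[OF assms] by (simp add: algebra_simps)
  then show "\<bar>Tr x - x\<bar> \<le> norm (\<sigma> x) + norm (\<tau> x)"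
    using norm_triangle_ineq[of "\<sigma> x" "\<tau> x"] by (simp only: norm_of_real)
  then show "\<bar>x - Tr x\<bar> \<le> norm (\<sigma> x) + norm (\<tau> x)" by (simp add: abs_minus_commute)
qed

text \<open>Replacing the weight \<open>\<bar>q\<bar>\<close> by \<open>\<bar>\<xi>\<bar>\<close>
  makes the product of the two weighted conjugates exactly a signed norm for every term, and not
  merely in the limit.\<close>

lemma A_half_seq:
  "v \<in> A_half a1 a2 \<longleftrightarrow> (\<exists>\<xi>. (\<forall>k. \<xi> k \<in> D) \<and> filterlim (\<lambda>k. \<bar>\<xi> k\<bar>) at_top sequentially \<and>
     (\<lambda>k. of_real (sqrt \<bar>\<xi> k\<bar>) * \<sigma> (\<xi> k)) \<longlonglongrightarrow> crdX v \<and>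
     (\<lambda>k. of_real (sqrt \<bar>\<xi> k\<bar>) * \<tau> (\<xi> k)) \<longlonglongrightarrow> crdY v)"
proof
  assume v: "v \<in> A_half a1 a2"
  have "\<exists>x q p1 p2. x \<in> D \<and> Tr x = of_int q \<and> Tr (x * a1) = of_int p1 \<and> Tr (x * a2) = of_int p2 \<and>
      real k < \<bar>Tr x\<bar> \<and> dist (approx_pt a1 a2 q p1 p2) v < inverse (real (Suc k))" for k
  proof -
    obtain q p1 p2 where q: "real k < \<bar>real_of_int q\<bar>" "dist (approx_pt a1 a2 q p1 p2) v < inverse (real (Suc k))"
      using v[unfolded A_half_iff[OF cub], rule_format, of "inverse (real (Suc k))" "real k"] by auto
    obtain x where "x \<in> D" "Tr x = of_int q" "Tr (x * a1) = of_int p1" "Tr (x * a2) = of_int p2"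
      by (rule dual_of_ints)
    then show ?thesis using q by metis
  qed
  then obtain \<xi> q p1 p2 where xi: "\<And>k. \<xi> k \<in> D" and tr: "\<And>k. Tr (\<xi> k) = of_int (q k)"
      "\<And>k. Tr (\<xi> k * a1) = of_int (p1 k)" "\<And>k. Tr (\<xi> k * a2) = of_int (p2 k)"
      and big: "\<And>k. real k < \<bar>Tr (\<xi> k)\<bar>"
      and near: "\<And>k. dist (approx_pt a1 a2 (q k) (p1 k) (p2 k)) v < inverse (real (Suc k))"
    by metis
  have xiK: "\<xi> k \<in> K" for k using xi dual_K by blast
  have "(\<lambda>k. dist (approx_pt a1 a2 (q k) (p1 k) (p2 k)) v) \<longlonglongrightarrow> 0"
    by (rule Lim_null_comparison[OF always_eventually LIMSEQ_inverse_real_of_nat], rule allI)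
      (simp only: real_norm_def abs_of_nonneg[OF zero_le_dist] less_imp_le[OF near])
  then have lim: "(\<lambda>k. approx_pt a1 a2 (q k) (p1 k) (p2 k)) \<longlonglongrightarrow> v"
    by (rule tendsto_dist_iff[THEN iffD2])
  have "(\<lambda>k. crdX (approx_pt a1 a2 (q k) (p1 k) (p2 k))) \<longlonglongrightarrow> crdX v"
    "(\<lambda>k. crdY (approx_pt a1 a2 (q k) (p1 k) (p2 k))) \<longlonglongrightarrow> crdY v"
    unfolding crdX_def crdY_def using lim disc_root_nonzero by (auto intro!: tendsto_intros)
  then have l: "(\<lambda>k. of_real (sqrt \<bar>Tr (\<xi> k)\<bar>) * \<sigma> (\<xi> k)) \<longlonglongrightarrow> crdX v"
    "(\<lambda>k. of_real (sqrt \<bar>Tr (\<xi> k)\<bar>) * \<tau> (\<xi> k)) \<longlonglongrightarrow> crdY v"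
    by (simp_all add: crd_approx_pt[OF xiK tr])
  have b: "filterlim (\<lambda>k. \<bar>Tr (\<xi> k)\<bar>) at_top sequentially"
    by (rule filterlim_at_top_mono[OF filterlim_real_sequentially])
       (use big in \<open>auto intro!: always_eventually less_imp_le\<close>)
  show "\<exists>\<xi>. (\<forall>k. \<xi> k \<in> D) \<and> filterlim (\<lambda>k. \<bar>\<xi> k\<bar>) at_top sequentially \<and>
     (\<lambda>k. of_real (sqrt \<bar>\<xi> k\<bar>) * \<sigma> (\<xi> k)) \<longlonglongrightarrow> crdX v \<and>
     (\<lambda>k. of_real (sqrt \<bar>\<xi> k\<bar>) * \<tau> (\<xi> k)) \<longlonglongrightarrow> crdY v"
    using rescale_by_asymptotic[OF b l, of \<xi>] trace_near[OF xiK] xi by blast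
next
  assume "\<exists>\<xi>. (\<forall>k. \<xi> k \<in> D) \<and> filterlim (\<lambda>k. \<bar>\<xi> k\<bar>) at_top sequentially \<and>
     (\<lambda>k. of_real (sqrt \<bar>\<xi> k\<bar>) * \<sigma> (\<xi> k)) \<longlonglongrightarrow> crdX v \<and>
     (\<lambda>k. of_real (sqrt \<bar>\<xi> k\<bar>) * \<tau> (\<xi> k)) \<longlonglongrightarrow> crdY v"
  then obtain \<xi> where xi: "\<And>k. \<xi> k \<in> D" and b: "filterlim (\<lambda>k. \<bar>\<xi> k\<bar>) at_top sequentially"
    and l: "(\<lambda>k. of_real (sqrt \<bar>\<xi> k\<bar>) * \<sigma> (\<xi> k)) \<longlonglongrightarrow> crdX v"
      "(\<lambda>k. of_real (sqrt \<bar>\<xi> k\<bar>) * \<tau> (\<xi> k)) \<longlonglongrightarrow> crdY v" by blast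
  have xiK: "\<xi> k \<in> K" for k using xi dual_K by blast
  have "\<exists>q p1 p2. Tr (\<xi> k) = of_int q \<and> Tr (\<xi> k * a1) = of_int p1 \<and> Tr (\<xi> k * a2) = of_int p2" for k
    using xi[of k] unfolding dual_iff by (metis Ints_cases)
  then obtain q p1 p2 where tr: "\<And>k. Tr (\<xi> k) = of_int (q k)"
      "\<And>k. Tr (\<xi> k * a1) = of_int (p1 k)" "\<And>k. Tr (\<xi> k * a2) = of_int (p2 k)" by metis
  have b': "filterlim (\<lambda>k. \<bar>Tr (\<xi> k)\<bar>) at_top sequentially"
    and l': "(\<lambda>k. of_real (sqrt \<bar>Tr (\<xi> k)\<bar>) * \<sigma> (\<xi> k)) \<longlonglongrightarrow> crdX v"
      "(\<lambda>k. of_real (sqrt \<bar>Tr (\<xi> k)\<bar>) * \<tau> (\<xi> k)) \<longlonglongrightarrow> crdY v"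
    using rescale_by_asymptotic[OF b l, of "\<lambda>k. Tr (\<xi> k)"] trace_near[OF xiK] by blast+
  define P where "P k = approx_pt a1 a2 (q k) (p1 k) (p2 k)" for k
  have c: "(\<lambda>k. crdX (P k)) \<longlonglongrightarrow> crdX v" "(\<lambda>k. crdY (P k)) \<longlonglongrightarrow> crdY v"
    using l' unfolding P_def by (simp_all add: crd_approx_pt[OF xiK tr])
  have "(\<lambda>k. complex_of_real (fst (P k))) \<longlonglongrightarrow> of_real (fst v)" "(\<lambda>k. complex_of_real (snd (P k))) \<longlonglongrightarrow> of_real (snd v)"
    unfolding crd_recover by (intro tendsto_intros c)+
  then have "(\<lambda>k. (fst (P k), snd (P k))) \<longlonglongrightarrow> (fst v, snd v)"
    unfolding tendsto_of_real_iff by (rule tendsto_Pair)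
  then have P: "P \<longlonglongrightarrow> v" by simp
  show "v \<in> A_half a1 a2"
    unfolding A_half_iff[OF cub]
  proof (intro allI impI)
    fix e M :: real assume "e > 0"
    have "eventually (\<lambda>k. dist (P k) v < e) sequentially" using P \<open>e > 0\<close> by (rule tendstoD)
    moreover have "eventually (\<lambda>k. max M 0 < \<bar>Tr (\<xi> k)\<bar>) sequentially"
      using b' unfolding filterlim_at_top_dense by blast
    ultimately have "eventually (\<lambda>k. dist (P k) v < e \<and> max M 0 < \<bar>Tr (\<xi> k)\<bar>) sequentially"
      by eventually_elim simp
    then obtain k where k: "dist (P k) v < e" "max M 0 < \<bar>Tr (\<xi> k)\<bar>"
      using eventually_happens' sequentially_bot by blast
    then show "\<exists>q p1 p2. M < \<bar>real_of_int q\<bar> \<and> q \<noteq> 0 \<and> dist (approx_pt a1 a2 q p1 p2) v < e"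
      unfolding P_def tr by (intro exI[of _ "q k"] exI[of _ "p1 k"] exI[of _ "p2 k"]) auto
  qed
qed

text \<open>The sign turns the norm into \<open>\<bar>x\<bar> * \<sigma> x * \<tau> x\<close>, which
  is the value of X Y and is the same for \<open>x\<close> and \<open>- x\<close>.\<close>

definition snorm :: "real \<Rightarrow> real" where
  "snorm x = sgn x * N x"

lemma snorm_conjugates: "x \<in> K \<Longrightarrow> of_real (snorm x) = of_real \<bar>x\<bar> * \<sigma> x * \<tau> x"
  unfolding snorm_def by (simp add: trace_norm_conjugates abs_sgn)

text \<open>The signed norms along the sequence have a common denominator and converge, so they are
  eventually constant. The limit is therefore attained by a term, and a late term is nonzero because
  its absolute value tends to infinity.\<close>

lemma A_half_snorm:
  assumes v: "v \<in> A_half a1 a2"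
  shows "\<exists>s \<in> D - {0}. crdX v * crdY v = of_real (snorm s)"
proof -
  obtain \<xi> where xi: "\<And>k. \<xi> k \<in> D" and b: "filterlim (\<lambda>k. \<bar>\<xi> k\<bar>) at_top sequentially"
    and l: "(\<lambda>k. of_real (sqrt \<bar>\<xi> k\<bar>) * \<sigma> (\<xi> k)) \<longlonglongrightarrow> crdX v"
      "(\<lambda>k. of_real (sqrt \<bar>\<xi> k\<bar>) * \<tau> (\<xi> k)) \<longlonglongrightarrow> crdY v"
    using v unfolding A_half_seq by blast
  have xiK: "\<xi> k \<in> K" for k using xi dual_K by blast
  obtain d :: int where d: "d > 0" "\<forall>s\<in>D. of_int d * N s \<in> \<int>" using norm_denom by blast
  have "of_real (sqrt \<bar>x\<bar>) * \<sigma> x * (of_real (sqrt \<bar>x\<bar>) * \<tau> x) = complex_of_real (sqrt \<bar>x\<bar> * sqrt \<bar>x\<bar>) * \<sigma> x * \<tau> x" for x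
    by (simp only: of_real_mult mult_ac)
  then have "of_real (sqrt \<bar>\<xi> k\<bar>) * \<sigma> (\<xi> k) * (of_real (sqrt \<bar>\<xi> k\<bar>) * \<tau> (\<xi> k)) = of_real (snorm (\<xi> k))" for k
    using snorm_conjugates[OF xiK] by simp
  then have lim: "(\<lambda>k. complex_of_real (snorm (\<xi> k))) \<longlonglongrightarrow> crdX v * crdY v"
    using tendsto_mult[OF l] by simp
  have "\<exists>n::int. of_int d * snorm (\<xi> k) = of_int n" for k
  proof -
    have "of_int d * N (\<xi> k) \<in> \<int>" using d xi by blast
    moreover have "sgn (\<xi> k) \<in> \<int>" by (simp add: sgn_if)
    ultimately have "sgn (\<xi> k) * (of_int d * N (\<xi> k)) \<in> \<int>" by simp
    then show ?thesis unfolding snorm_def by (metis Ints_cases mult.left_commute)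
  qed
  then obtain n where n: "\<And>k. of_int d * snorm (\<xi> k) = of_int (n k)" by metis
  have "(\<lambda>k. of_int d * complex_of_real (snorm (\<xi> k))) \<longlonglongrightarrow> of_int d * (crdX v * crdY v)"
    by (intro tendsto_intros lim)
  moreover have "of_int d * complex_of_real (snorm (\<xi> k)) = of_int (n k)" for k
    using n[of k] by (metis of_real_mult of_real_of_int_eq)
  ultimately have nl: "(\<lambda>k. complex_of_int (n k)) \<longlonglongrightarrow> of_int d * (crdX v * crdY v)" by simp
  obtain M where M: "\<And>k. k \<ge> M \<Longrightarrow> dist (complex_of_int (n k)) (of_int (n M)) < 1"
    using LIMSEQ_imp_Cauchy[OF nl] unfolding Cauchy_def by (metis order_refl zero_less_one)
  have const: "n k = n M" if "k \<ge> M" for k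
  proof -
    have "norm (complex_of_int (n k - n M)) < 1"
      using M[OF that] by (simp add: dist_norm)
    then show ?thesis by (simp only: norm_of_int)
  qed
  have "(\<lambda>k. complex_of_int (n k)) \<longlonglongrightarrow> of_int (n M)"
    by (rule tendsto_eventually, unfold eventually_sequentially) (metis const)
  then have e: "of_int d * (crdX v * crdY v) = of_int (n M)"
    using nl LIMSEQ_unique by blast
  obtain k where k: "k \<ge> M" "\<bar>\<xi> k\<bar> > 0"
    using filterlim_at_top_dense[THEN iffD1, OF b, rule_format, of 0]
    unfolding eventually_sequentially by (metis nle_le)
  have "of_int d * (crdX v * crdY v) = of_int d * complex_of_real (snorm (\<xi> k))"
    unfolding e using n[of k] const[OF k(1)] by (metis of_real_mult of_real_of_int_eq)
  then show ?thesis using d(1) xi[of k] k(2) by (intro bexI[of _ "\<xi> k"]) auto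
qed

end

section \<open>Units from Dirichlet approximation\<close>

context cubic_conjugates begin

lemma norm_mult: "x \<in> K \<Longrightarrow> y \<in> K \<Longrightarrow> N (x * y) = N x * N y"
proof -
  assume "x \<in> K" "y \<in> K"
  then have "complex_of_real (N (x * y)) = of_real (N x * N y)"
    by (simp add: trace_norm_conjugates K_closed embedding_mult[OF emb(1)] embedding_mult[OF emb(2)])
  then show ?thesis by (simp only: of_real_eq_iff)
qed

lemma norm_rat: "r \<in> \<rat> \<Longrightarrow> N r = r ^ 3"
proof -
  assume "r \<in> \<rat>"
  then have "complex_of_real (N r) = of_real (r ^ 3)"
    by (simp add: trace_norm_conjugates K_closed embedding_rat[OF emb(1)] embedding_rat[OF emb(2)] power3_eq_cube)
  then show ?thesis by (simp only: of_real_eq_iff)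
qed

lemma norm_divide: "x \<in> K \<Longrightarrow> y \<in> K \<Longrightarrow> y \<noteq> 0 \<Longrightarrow> N (x / y) = N x / N y"
  using norm_mult[of "x / y" y] norm_nonzero[of y] by (simp add: K_closed)

text \<open>With \<open>u\<close> quadratic in \<open>a1\<close>, the difference of its conjugates
  is divisible by \<open>\<sigma> a1 - \<tau> a1\<close>. The remaining factor involves only the sum
  of these conjugates, which is \<open>Tr a1 - a1\<close>, so its vanishing is a rational relation
  between 1 and \<open>a1\<close>.\<close>

lemma rational_if_conjugates_eq:
  assumes u: "u \<in> K" and eq: "\<sigma> u = \<tau> u"
  shows "u \<in> \<rat>"
proof -
  have "u \<in> Kset a1 (a1\<^sup>2)" using u cubic_power_basis(2)[OF cub] by simp
  then obtain c0 c1 c2 where c: "c0 \<in> \<rat>" "c1 \<in> \<rat>" "c2 \<in> \<rat>" "u = c0 + c1 * a1 + c2 * a1\<^sup>2"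
    by (rule KsetE)
  have *: "\<rho> u = of_real c0 + of_real c1 * \<rho> a1 + of_real c2 * (\<rho> a1 * \<rho> a1)"
    if "complex_embedding a1 a2 \<rho>" for \<rho>
    using embedding_lincomb[OF cub that c(1-3) Kset_gens(1) cubic_mult[OF cub Kset_gens(1) Kset_gens(1)]]
      embedding_mult[OF that Kset_gens(1) Kset_gens(1)] c(4) by (simp add: power2_eq_square)
  have "(\<sigma> a1 - \<tau> a1) * (of_real c1 + of_real c2 * (\<sigma> a1 + \<tau> a1)) = \<sigma> u - \<tau> u"
    unfolding *[OF emb(1)] *[OF emb(2)] by (simp add: algebra_simps)
  then have "of_real c1 + of_real c2 * (\<sigma> a1 + \<tau> a1) = 0" using eq distinct(3) by simp
  moreover have "\<sigma> a1 + \<tau> a1 = of_real (Tr a1 - a1)"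
    using trace_norm_conjugates(1)[OF Kset_gens(1)] by (simp add: algebra_simps)
  ultimately have "complex_of_real (c1 + c2 * (Tr a1 - a1)) = 0" by simp
  then have "c1 + c2 * (Tr a1 - a1) = 0" by (simp only: of_real_eq_0_iff)
  then have z: "(c1 + c2 * Tr a1) + (- c2) * a1 + 0 * a2 = 0" by (simp add: algebra_simps)
  have "c1 + c2 * Tr a1 \<in> \<rat>" "- c2 \<in> \<rat>" using c trace_rat[OF Kset_gens(1)] by simp_all
  then have "c1 + c2 * Tr a1 = 0" "- c2 = 0" using cubic_indep[OF cub _ _ Rats_0 z] by auto
  then show ?thesis using c by simp
qed

text \<open>The positive units of norm 1 in the multiplier ring of D. Positivity and norm 1 together
  keep \<open>snorm (s * u)\<close> equal to \<open>snorm s\<close>, so that multiplication by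
  \<open>u\<close> moves points along one curve.\<close>

definition unit_grp :: "real set" where
  "unit_grp = {u \<in> K. u > 0 \<and> N u = 1 \<and> (\<forall>s\<in>D. s * u \<in> D) \<and> (\<forall>s\<in>D. s / u \<in> D)}"

lemma unit_grp_K: "u \<in> unit_grp \<Longrightarrow> u \<in> K" and unit_grp_pos: "u \<in> unit_grp \<Longrightarrow> u > 0"
  and unit_grp_norm: "u \<in> unit_grp \<Longrightarrow> N u = 1" and unit_grp_dual: "u \<in> unit_grp \<Longrightarrow> s \<in> D \<Longrightarrow> s * u \<in> D"
  unfolding unit_grp_def by blast+

lemma unit_grp_one: "1 \<in> unit_grp"
  unfolding unit_grp_def by (simp add: K_closed norm_rat)

lemma unit_grp_mult: "u \<in> unit_grp \<Longrightarrow> w \<in> unit_grp \<Longrightarrow> u * w \<in> unit_grp"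
  unfolding unit_grp_def by (auto simp: K_closed norm_mult simp flip: mult.assoc divide_divide_eq_left)

lemma unit_grp_inverse: "u \<in> unit_grp \<Longrightarrow> 1 / u \<in> unit_grp"
  unfolding unit_grp_def by (auto simp: K_closed norm_divide norm_rat)

lemma unit_grp_power: "u \<in> unit_grp \<Longrightarrow> u ^ n \<in> unit_grp"
  by (induction n) (simp_all add: unit_grp_one unit_grp_mult)

text \<open>On a curve X Y = const with nonzero constant, the quotient X / Y determines the point up
  to sign, since X squared is X Y times X / Y.\<close>

definition ratio :: "real \<Rightarrow> complex" where
  "ratio x = \<sigma> x / \<tau> x"

lemma conj_nonzero: "x \<in> K \<Longrightarrow> x \<noteq> 0 \<Longrightarrow> \<sigma> x \<noteq> 0" "x \<in> K \<Longrightarrow> x \<noteq> 0 \<Longrightarrow> \<tau> x \<noteq> 0"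
  using embedding_nonzero[OF cub] emb by blast+

lemma ratio_mult: "x \<in> K \<Longrightarrow> y \<in> K \<Longrightarrow> ratio (x * y) = ratio x * ratio y"
  unfolding ratio_def by (simp add: embedding_mult[OF emb(1)] embedding_mult[OF emb(2)])

lemma ratio_divide: "x \<in> K \<Longrightarrow> y \<in> K \<Longrightarrow> y \<noteq> 0 \<Longrightarrow> ratio (x / y) = ratio x / ratio y"
  unfolding ratio_def by (simp add: embedding_divide[OF cub emb(1)] embedding_divide[OF cub emb(2)])

lemma ratio_one: "ratio 1 = 1"
  unfolding ratio_def using emb unfolding complex_embedding_def by simp

lemma ratio_power: "u \<in> unit_grp \<Longrightarrow> ratio (u ^ n) = ratio u ^ n"
  by (induction n) (simp_all add: ratio_one ratio_mult unit_grp_K unit_grp_power)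

text \<open>Simultaneous approximation of \<open>a1\<close> and \<open>a2\<close> with denominator
  at most n^2 has error below 1/n. The three bounds balance so that the norm, being the product of
  the three conjugates, stays bounded as \<open>n\<close> grows.\<close>

lemma dirichlet_dual:
  "\<exists>C \<xi>. C > 0 \<and> (\<forall>n>0. \<xi> n \<in> D \<and> \<xi> n \<noteq> 0 \<and> \<bar>\<xi> n\<bar> \<le> C * real n ^ 2 \<and>
      norm (\<sigma> (\<xi> n)) \<le> C / real n \<and> norm (\<tau> (\<xi> n)) \<le> C / real n)"
proof -
  \<comment> \<open>A bound for the linear maps \<open>crdX\<close> and \<open>crdY\<close> with
    respect to the maximum norm on the plane.\<close>
  define B where "B = (norm (of_real a1 - \<sigma> a1) + norm (of_real a2 - \<sigma> a2)
     + norm (of_real a1 - \<tau> a1) + norm (of_real a2 - \<tau> a2)) / norm disc_root"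
  have B0: "B \<ge> 0" unfolding B_def by simp
  have bd: "norm (crdX v) \<le> B * t" "norm (crdY v) \<le> B * t" if v: "\<bar>fst v\<bar> \<le> t" "\<bar>snd v\<bar> \<le> t" for v t
  proof -
    have t: "t \<ge> 0" using v by linarith
    have gen: "norm ((z * of_real x - z' * of_real y) / disc_root) \<le> B * t"
      if "\<bar>x\<bar> \<le> t" "\<bar>y\<bar> \<le> t" "norm z + norm z' \<le> B * norm disc_root" for z z' x y
    proof -
      have "norm (z * of_real x - z' * of_real y) \<le> norm z * \<bar>x\<bar> + norm z' * \<bar>y\<bar>"
        using norm_triangle_ineq4[of "z * of_real x" "z' * of_real y"] by (simp add: Real_Vector_Spaces.norm_mult)
      also have "\<dots> \<le> norm z * t + norm z' * t"
        by (intro add_mono mult_left_mono that) auto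
      also have "\<dots> = (norm z + norm z') * t" by (simp add: algebra_simps)
      also have "\<dots> \<le> (B * norm disc_root) * t" by (intro mult_right_mono that t)
      finally have "norm (z * of_real x - z' * of_real y) \<le> (B * t) * norm disc_root"
        by (simp add: mult_ac)
      then show ?thesis using disc_root_nonzero by (simp add: Real_Vector_Spaces.norm_divide divide_le_eq)
    qed
    have Bd: "B * norm disc_root = norm (of_real a1 - \<sigma> a1) + norm (of_real a2 - \<sigma> a2)
     + norm (of_real a1 - \<tau> a1) + norm (of_real a2 - \<tau> a2)"
      unfolding B_def using disc_root_nonzero by simp
    show "norm (crdX v) \<le> B * t" "norm (crdY v) \<le> B * t"
      unfolding crdX_def crdY_def by (intro gen v; simp add: Bd)+
  qed
  \<comment> \<open>The element differs from its trace by at most 2 \<open>B\<close>, and the trace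
    is at most n^2; hence 1 + 2 \<open>B\<close> times n^2 bounds the element, while the conjugates
    only need a constant of at least \<open>B\<close>.\<close>
  define C where "C = 1 + 2 * B"
  have "\<exists>x. n > 0 \<longrightarrow> (x \<in> D \<and> x \<noteq> 0 \<and> \<bar>x\<bar> \<le> C * real n ^ 2 \<and>
      norm (\<sigma> x) \<le> C / real n \<and> norm (\<tau> x) \<le> C / real n)" for n
  proof (cases "n > 0")
    case n: True
    obtain q p where q: "0 < q" "q \<le> int (n ^ 2)"
      and p: "\<And>i::nat. i < 2 \<Longrightarrow> \<bar>of_int q * (if i = 0 then a1 else a2) - of_int (p i)\<bar> < 1 / real n"
    proof (rule Dirichlet_approx_simult[OF n, of 2 "\<lambda>i. if i = 0 then a1 else a2"])
      fix q p assume "0 < q" "q \<le> int (n ^ 2)"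
        "\<And>i::nat. i < 2 \<Longrightarrow> \<bar>of_int q * (if i = 0 then a1 else a2) - of_int (p i)\<bar> < 1 / real n"
      then show thesis by (rule that)
    qed
    obtain x where x: "x \<in> D" "Tr x = of_int q" "Tr (x * a1) = of_int (p 0)" "Tr (x * a2) = of_int (p 1)"
      by (rule dual_of_ints)
    have xK: "x \<in> K" using x dual_K by blast
    have "\<bar>of_int q * a1 - of_int (p 0)\<bar> \<le> 1 / real n" "\<bar>of_int q * a2 - of_int (p 1)\<bar> \<le> 1 / real n"
      using p[of 0] p[of 1] by simp_all
    then have b: "norm (\<sigma> x) \<le> B * (1 / real n)" "norm (\<tau> x) \<le> B * (1 / real n)"
      unfolding crd_trace[OF xK, symmetric] x by (intro bd; simp)+
    have "B * (1 / real n) \<le> B * 1" using n B0 by (intro mult_left_mono) auto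
    then have "\<bar>x\<bar> \<le> \<bar>Tr x\<bar> + 2 * B" using trace_near(1)[OF xK] b by linarith
    also have "\<bar>Tr x\<bar> \<le> real n ^ 2"
      using q x(2) by (metis abs_of_pos of_int_0_less_iff of_int_le_iff of_int_of_nat_eq of_nat_power)
    also have "real n ^ 2 + 2 * B \<le> C * real n ^ 2"
    proof -
      have "1 \<le> real n ^ 2" using n by simp
      then have "2 * B * 1 \<le> 2 * B * real n ^ 2" using B0 by (intro mult_left_mono) auto
      then show ?thesis unfolding C_def by (simp add: algebra_simps)
    qed
    finally have "\<bar>x\<bar> \<le> C * real n ^ 2" by simp
    moreover have "B * (1 / real n) \<le> C / real n"
      using n B0 unfolding C_def by (simp add: divide_right_mono)
    moreover have "x \<noteq> 0"
    proof
      assume "x = 0"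
      then have "Tr x = 0" using trace_add[of 0 0] by (simp add: K_closed)
      then show False using x(2) q(1) by simp
    qed
    ultimately show ?thesis using x(1) b by (intro exI[of _ x]) auto
  qed auto
  then obtain \<xi> where "\<forall>n. n > 0 \<longrightarrow> (\<xi> n \<in> D \<and> \<xi> n \<noteq> 0 \<and> \<bar>\<xi> n\<bar> \<le> C * real n ^ 2 \<and>
      norm (\<sigma> (\<xi> n)) \<le> C / real n \<and> norm (\<tau> (\<xi> n)) \<le> C / real n)" by metis
  moreover have "C > 0" unfolding C_def using B0 by simp
  ultimately show ?thesis by blast
qed

text \<open>The quotient is 1 plus \<open>of_int m * l / x\<close>. As \<open>m\<close> contains the
  factor \<open>N x\<close>, the division by \<open>x\<close> becomes multiplication by the cofactor
  \<open>N x / x\<close>. The two factors \<open>d\<close> clear the product of \<open>s\<close>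
  with \<open>l\<close> and the product of the result with the cofactor, which itself is cleared by
  \<open>d'\<close>.\<close>

lemma congruent_quotient:
  fixes d d' j m :: int
  assumes d: "\<And>s t. s \<in> D \<Longrightarrow> t \<in> D \<Longrightarrow> of_int d * (s * t) \<in> D"
    and d': "\<And>s. s \<in> D \<Longrightarrow> s \<noteq> 0 \<Longrightarrow> of_int d' * (N s / s) \<in> D"
    and x: "x \<in> D" "x \<noteq> 0" and l: "l \<in> D" and y: "y = x + of_int m * l"
    and m: "of_int m = N x * of_int (d * d * d' * j)" and s: "s \<in> D"
  shows "s * (y / x) \<in> D"
proof -
  have "s * (y / x) = s + of_int j * (of_int d * ((of_int d * (s * l)) * (of_int d' * (N x / x))))"
    unfolding y m using x(2) by (simp add: field_simps)
  then show ?thesis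
    using dual_add[OF s dual_int_mult[OF d[OF d[OF s l] d'[OF x]]]] by simp
qed

lemma dual_divide_int:
  assumes "x \<in> K" "of_int m * r0 = Tr x" "of_int m * r1 = Tr (x * a1)" "of_int m * r2 = Tr (x * a2)"
    and "r0 \<in> \<int>" "r1 \<in> \<int>" "r2 \<in> \<int>" "m \<noteq> 0"
  shows "x / of_int m \<in> D"
proof -
  have t: "Tr (z / of_int m) = Tr z / of_int m" if "z \<in> K" for z
    using trace_scale[of "1 / of_int m" z] that by simp
  have "x / of_int m * a1 = (x * a1) / of_int m" "x / of_int m * a2 = (x * a2) / of_int m" by simp_all
  then have "Tr (x / of_int m) = r0" "Tr (x / of_int m * a1) = r1" "Tr (x / of_int m * a2) = r2"
    using assms by (simp_all only: t K_closed) (simp_all add: field_simps)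
  then show ?thesis using assms unfolding dual_iff by (simp add: K_closed)
qed

text \<open>Dirichlet's theorem yields lattice elements of bounded norm whose ratios of conjugates stay in a
  compact subset of the punctured plane; quotients of two of them with equal norm and equal residues are units.\<close>

lemma unit_small_ratio:
  fixes \<epsilon> M :: real
  assumes eps: "\<epsilon> > 0"
  shows "\<exists>u \<in> unit_grp. M < u \<and> ratio u \<noteq> 1 \<and> norm (ratio u - 1) < \<epsilon>"
proof -
  obtain C \<xi> where C: "C > 0" and xi: "\<And>n. n > 0 \<Longrightarrow> \<xi> n \<in> D" "\<And>n. n > 0 \<Longrightarrow> \<xi> n \<noteq> 0"
     "\<And>n. n > 0 \<Longrightarrow> \<bar>\<xi> n\<bar> \<le> C * real n ^ 2" "\<And>n. n > 0 \<Longrightarrow> norm (\<sigma> (\<xi> n)) \<le> C / real n"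
     "\<And>n. n > 0 \<Longrightarrow> norm (\<tau> (\<xi> n)) \<le> C / real n"
    using dirichlet_dual by blast
  obtain d :: int where d: "d > 0" "\<And>s t. s \<in> D \<Longrightarrow> t \<in> D \<Longrightarrow> of_int d * (s * t) \<in> D"
    using dual_mult_denom by blast
  obtain d' :: int where d': "d' > 0" "\<And>s. s \<in> D \<Longrightarrow> s \<noteq> 0 \<Longrightarrow> of_int d' * (N s / s) \<in> D"
    using dual_cofactor_denom by blast
  obtain dn :: int where dn: "dn > 0" "\<And>s. s \<in> D \<Longrightarrow> of_int dn * N s \<in> \<int>"
    using norm_denom by blast
  have xiK: "\<xi> n \<in> K" if "n > 0" for n using xi(1)[OF that] dual_K by blast
  have absN: "\<bar>N x\<bar> = \<bar>x\<bar> * norm (\<sigma> x) * norm (\<tau> x)" if "x \<in> K" for x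
  proof -
    have "norm (complex_of_real (N x)) = norm (of_real x * \<sigma> x * \<tau> x)"
      using trace_norm_conjugates(2)[OF that] by simp
    then show ?thesis by (simp add: Real_Vector_Spaces.norm_mult)
  qed
  have upper: "\<bar>N (\<xi> n)\<bar> \<le> C ^ 3" if n: "n > 0" for n
  proof -
    have "\<bar>N (\<xi> n)\<bar> \<le> (C * real n ^ 2) * (C / real n) * (C / real n)"
      unfolding absN[OF xiK[OF n]] using C by (intro mult_mono xi(3-5)[OF n]) auto
    then show ?thesis using n by (simp add: power2_eq_square power3_eq_cube)
  qed
  have lower: "1 \<le> of_int dn * \<bar>N (\<xi> n)\<bar>" if n: "n > 0" for n
  proof -
    have "of_int dn * N (\<xi> n) \<in> \<int>" "of_int dn * N (\<xi> n) \<noteq> 0"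
      using dn xi(1)[OF n] norm_nonzero[OF xiK[OF n] xi(2)[OF n]] by auto
    then have "1 \<le> \<bar>of_int dn * N (\<xi> n)\<bar>" by (rule Ints_nonzero_abs_ge1)
    then show ?thesis using dn(1) by (simp add: abs_mult)
  qed
  define B where "B = of_int dn * C ^ 3"
  have dnr: "real_of_int dn > 0" using dn by simp
  have B: "B > 0" unfolding B_def using C dnr by simp
  \<comment> \<open>The norm is bounded below while both conjugates are at most
    \<open>C / real n\<close>, so the element itself must grow at least like n^2. This will make the
    quotient of a late by an early element as large as desired.\<close>
  have big: "real n ^ 2 \<le> of_int dn * C ^ 2 * \<bar>\<xi> n\<bar>" if n: "n > 0" for n
  proof -
    have "\<bar>\<xi> n\<bar> * norm (\<sigma> (\<xi> n)) * norm (\<tau> (\<xi> n)) \<le> \<bar>\<xi> n\<bar> * (C / real n) * (C / real n)"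
      using C by (intro mult_mono xi(4,5)[OF n]) auto
    then have "of_int dn * \<bar>N (\<xi> n)\<bar> \<le> of_int dn * (\<bar>\<xi> n\<bar> * (C / real n) * (C / real n))"
      unfolding absN[OF xiK[OF n]] using dnr by (intro mult_left_mono) auto
    then have "1 \<le> of_int dn * (\<bar>\<xi> n\<bar> * (C / real n) * (C / real n))"
      using lower[OF n] by linarith
    then show ?thesis using n by (simp add: field_simps power2_eq_square)
  qed
  \<comment> \<open>Neither conjugate can be much smaller than the other: the lower bound for the
    norm makes \<open>z'\<close> at least 1 / (dn C^2 n), while \<open>z\<close> is at most C / n.
    With the two conjugates in either order this encloses the ratio between 1 / \<open>B\<close> and
    \<open>B\<close>.\<close>
  have conjratio: "norm z \<le> B * norm z'"
    if n: "n > 0" and z: "norm z \<le> C / real n" and zz: "norm z * norm z' = norm (\<sigma> (\<xi> n)) * norm (\<tau> (\<xi> n))"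
    for n and z z' :: complex
  proof -
    have "1 \<le> of_int dn * (\<bar>\<xi> n\<bar> * (norm z * norm z'))"
      using lower[OF n] unfolding absN[OF xiK[OF n]] zz by (simp add: mult.assoc)
    also have "\<dots> \<le> of_int dn * ((C * real n ^ 2) * ((C / real n) * norm z'))"
      using dnr C by (intro mult_left_mono mult_mono xi(3)[OF n] z mult_right_mono) auto
    finally have "1 \<le> of_int dn * C ^ 2 * real n * norm z'" using n by (simp add: power2_eq_square mult_ac)
    then have "norm z * 1 \<le> C / real n * (of_int dn * C ^ 2 * real n * norm z')"
      using C n by (intro mult_mono z) auto
    then show ?thesis using n unfolding B_def by (simp add: power2_eq_square power3_eq_cube mult_ac)
  qed
  have rat: "norm (ratio (\<xi> n)) \<le> B" "1 \<le> B * norm (ratio (\<xi> n))" if n: "n > 0" for n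
  proof -
    have nz: "norm (\<sigma> (\<xi> n)) > 0" "norm (\<tau> (\<xi> n)) > 0" using conj_nonzero xiK[OF n] xi(2)[OF n] by auto
    show "norm (ratio (\<xi> n)) \<le> B"
      using conjratio[OF n xi(4)[OF n] refl] nz unfolding ratio_def Real_Vector_Spaces.norm_divide by (simp add: divide_le_eq)
    show "1 \<le> B * norm (ratio (\<xi> n))"
      using conjratio[OF n xi(5)[OF n], of "\<sigma> (\<xi> n)"] nz unfolding ratio_def Real_Vector_Spaces.norm_divide
      by (simp add: le_divide_eq mult.commute)
  qed
  have "(\<lambda>n. N (\<xi> n)) ` {0<..} \<subseteq> (\<lambda>k. of_int k / of_int dn) ` {- \<lceil>B\<rceil>..\<lceil>B\<rceil>}"
  proof
    fix y assume "y \<in> (\<lambda>n. N (\<xi> n)) ` {0<..}"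
    then obtain n where n: "n > 0" "y = N (\<xi> n)" by auto
    obtain k where k: "of_int dn * N (\<xi> n) = real_of_int k" using dn(2)[OF xi(1)[OF n(1)]] Ints_cases by blast
    have "\<bar>of_int dn * N (\<xi> n)\<bar> \<le> B"
      unfolding abs_mult B_def using dnr upper[OF n(1)] by (simp add: mult_left_mono)
    then have "k \<in> {- \<lceil>B\<rceil>..\<lceil>B\<rceil>}" unfolding k by simp linarith
    moreover have "y = of_int k / of_int dn" using k dnr n(2) by (simp add: field_simps)
    ultimately show "y \<in> (\<lambda>k. of_int k / of_int dn) ` {- \<lceil>B\<rceil>..\<lceil>B\<rceil>}" by blast
  qed
  then have "finite ((\<lambda>n. N (\<xi> n)) ` {0<..})" by (rule finite_subset) simp
  then obtain n0 where n0: "n0 > 0" and inf1: "infinite {n \<in> {0<..}. N (\<xi> n) = N (\<xi> n0)}"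
    using pigeonhole_infinite[of "{0::nat<..}" "\<lambda>n. N (\<xi> n)"] infinite_Ioi by auto
  obtain k0 where k0: "of_int dn * N (\<xi> n0) = real_of_int k0" using dn(2)[OF xi(1)[OF n0(1)]] Ints_cases by blast
  have k0nz: "k0 \<noteq> 0" using lower[OF n0] k0 dnr by (auto simp: abs_mult)
  \<comment> \<open>This modulus is the one that \<open>congruent_quotient\<close> asks for when the
    norm is \<open>N (\<xi> n0)\<close>: \<open>k0\<close> is that norm times \<open>dn\<close>, and
    the other factors are the denominators for products and cofactors.\<close>
  define m where "m = \<bar>k0\<bar> * d * d * d'"
  have m: "m > 0" unfolding m_def using k0nz d d' by simp
  define A where "A = {n \<in> {0<..}. N (\<xi> n) = N (\<xi> n0)}"
  \<comment> \<open>Equal residues of the three traces make a difference divisible by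
    \<open>m\<close> within D. The sign is included so that the quotient of two such elements is
    positive.\<close>
  define res where "res n = (\<lfloor>Tr (\<xi> n)\<rfloor> mod m, \<lfloor>Tr (\<xi> n * a1)\<rfloor> mod m, \<lfloor>Tr (\<xi> n * a2)\<rfloor> mod m, \<xi> n > 0)" for n
  have "res ` A \<subseteq> {0..<m} \<times> {0..<m} \<times> {0..<m} \<times> UNIV" unfolding res_def using m by auto
  then have "finite (res ` A)" by (rule finite_subset) auto
  then obtain n1 where inf2: "infinite {n \<in> A. res n = res n1}"
    using pigeonhole_infinite[of A res] inf1 unfolding A_def by blast
  obtain r :: "nat \<Rightarrow> nat" where r: "strict_mono r" "\<And>k. r k \<in> {n \<in> A. res n = res n1}"
    using infinite_enumerate[OF inf2] by blast
  have rpos: "r k > 0" and rN: "N (\<xi> (r k)) = N (\<xi> n0)" and rres: "res (r k) = res n1" for k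
    using r(2)[of k] unfolding A_def by auto
  have "bounded (range (\<lambda>k. ratio (\<xi> (r k))))"
    by (rule boundedI[of _ B]) (use rat(1) rpos in auto)
  then obtain \<rho> r' where r': "strict_mono r'" "((\<lambda>k. ratio (\<xi> (r k))) \<circ> r') \<longlonglongrightarrow> \<rho>"
    using bounded_imp_convergent_subsequence by blast
  \<comment> \<open>The closeness is measured against 1 / \<open>B\<close> because the difference of
    two ratios will be divided by a ratio of absolute value at least 1 / \<open>B\<close>.\<close>
  have "\<epsilon> / B > 0" using eps B by simp
  then obtain k1 where k1: "\<And>k l. k \<ge> k1 \<Longrightarrow> l \<ge> k1 \<Longrightarrow> dist (ratio (\<xi> (r (r' k)))) (ratio (\<xi> (r (r' l)))) < \<epsilon> / B"
    using LIMSEQ_imp_Cauchy[OF r'(2)] unfolding Cauchy_def by (metis comp_apply)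
  define x where "x = \<xi> (r (r' k1))"
  have "filterlim (\<lambda>l. real (r (r' l)) ^ 2) at_top sequentially"
  proof (rule filterlim_at_top_mono[OF filterlim_real_sequentially], rule always_eventually, rule allI)
    fix l
    have "l \<le> r' l" "r' l \<le> r (r' l)" using seq_suble r(1) r'(1) by blast+
    then have "real l \<le> real (r (r' l))" by linarith
    also have "\<dots> \<le> real (r (r' l)) ^ 2" using rpos[of "r' l"] by (simp add: self_le_power)
    finally show "real l \<le> real (r (r' l)) ^ 2" .
  qed
  then have "eventually (\<lambda>l. of_int dn * C ^ 2 * (max M 1 * \<bar>x\<bar>) < real (r (r' l)) ^ 2) sequentially"
    unfolding filterlim_at_top_dense by blast
  then have "eventually (\<lambda>l. of_int dn * C ^ 2 * (max M 1 * \<bar>x\<bar>) < real (r (r' l)) ^ 2 \<and> l \<ge> k1) sequentially"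
    using eventually_ge_at_top[of k1] by eventually_elim simp
  then obtain l where l: "of_int dn * C ^ 2 * (max M 1 * \<bar>x\<bar>) < real (r (r' l)) ^ 2" "l \<ge> k1"
    using eventually_happens' sequentially_bot by blast
  define y where "y = \<xi> (r (r' l))"
  have xy: "x \<in> D" "y \<in> D" "x \<noteq> 0" "y \<noteq> 0" "N x = N (\<xi> n0)" "N y = N (\<xi> n0)"
    unfolding x_def y_def using xi(1,2)[OF rpos] rN by auto
  have xyK: "x \<in> K" "y \<in> K" using xy dual_K by auto
  have "of_int dn * C ^ 2 * (max M 1 * \<bar>x\<bar>) < of_int dn * C ^ 2 * \<bar>y\<bar>"
    using l(1) big[OF rpos[of "r' l"]] unfolding y_def by linarith
  then have gt: "max M 1 * \<bar>x\<bar> < \<bar>y\<bar>" using dnr C by (simp add: mult_less_cancel_left_pos)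
  have reseq: "res (r (r' k1)) = res (r (r' l))" using rres by simp
  have same: "x > 0 \<longleftrightarrow> y > 0" using reseq unfolding res_def x_def y_def by simp
  then have pos: "y / x > 0" using xy(3,4) by (auto simp: zero_less_divide_iff)
  have ugt: "max M 1 < y / x"
  proof -
    have "\<bar>y\<bar> / \<bar>x\<bar> = y / x" using pos by (metis abs_divide abs_of_pos)
    then show ?thesis using gt xy(3) by (metis less_divide_eq zero_less_abs_iff)
  qed
  have trint: "\<exists>k. real_of_int m * real_of_int k = Tr (y * b) - Tr (x * b)"
    if b: "Tr (x * b) \<in> \<int>" "Tr (y * b) \<in> \<int>" "\<lfloor>Tr (x * b)\<rfloor> mod m = \<lfloor>Tr (y * b)\<rfloor> mod m" for b
  proof -
    obtain k where "\<lfloor>Tr (y * b)\<rfloor> - \<lfloor>Tr (x * b)\<rfloor> = m * k"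
      using b(3) by (metis mod_eq_dvd_iff dvdE)
    then have "real_of_int (\<lfloor>Tr (y * b)\<rfloor> - \<lfloor>Tr (x * b)\<rfloor>) = real_of_int m * real_of_int k" by simp
    then show ?thesis using b(1,2) by (auto elim!: Ints_cases)
  qed
  have trs: "Tr (x * 1) \<in> \<int>" "Tr (y * 1) \<in> \<int>" "Tr (x * a1) \<in> \<int>" "Tr (y * a1) \<in> \<int>" "Tr (x * a2) \<in> \<int>" "Tr (y * a2) \<in> \<int>"
    using xy(1,2) unfolding dual_iff by auto
  have md: "\<lfloor>Tr (x * 1)\<rfloor> mod m = \<lfloor>Tr (y * 1)\<rfloor> mod m" "\<lfloor>Tr (x * a1)\<rfloor> mod m = \<lfloor>Tr (y * a1)\<rfloor> mod m"
    "\<lfloor>Tr (x * a2)\<rfloor> mod m = \<lfloor>Tr (y * a2)\<rfloor> mod m"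
    using reseq unfolding res_def x_def y_def by simp_all
  obtain j0 j1 j2 where j: "real_of_int m * real_of_int j0 = Tr (y * 1) - Tr (x * 1)"
    "real_of_int m * real_of_int j1 = Tr (y * a1) - Tr (x * a1)"
    "real_of_int m * real_of_int j2 = Tr (y * a2) - Tr (x * a2)"
    using trint[OF trs(1,2) md(1)] trint[OF trs(3,4) md(2)] trint[OF trs(5,6) md(3)] by blast
  have trd: "Tr ((y - x) * b) = Tr (y * b) - Tr (x * b)" if "b \<in> K" for b
    using trace_add[of "y * b" "(- 1) * (x * b)"] trace_scale[of "-1" "x * b"] xyK that
    by (simp add: K_closed algebra_simps)
  have lamD: "(y - x) / of_int m \<in> D"
    using dual_divide_int[of "y - x" m "of_int j0" "of_int j1" "of_int j2"] j m
      trd[of 1] trd[of a1] trd[of a2] xyK by (simp add: K_closed)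
  have mN: "of_int m = N (\<xi> n0) * of_int (d * d * d' * (sgn k0 * dn))"
  proof -
    have "real_of_int m = (of_int dn * N (\<xi> n0)) * of_int (sgn k0 * d * d * d')"
      unfolding k0 m_def by (simp add: abs_sgn)
    then show ?thesis by (simp add: mult_ac)
  qed
  have ml: "y = x + of_int m * ((y - x) / of_int m)" "x = y + of_int m * - ((y - x) / of_int m)"
    using m by simp_all
  have D1: "s * (y / x) \<in> D" if "s \<in> D" for s
    by (rule congruent_quotient[where m = m and j = "sgn k0 * dn", OF d(2) d'(2) xy(1,3) lamD ml(1) _ that]) (use mN xy in auto)
  have D2: "s * (x / y) \<in> D" if "s \<in> D" for s
    by (rule congruent_quotient[where m = m and j = "sgn k0 * dn", OF d(2) d'(2) xy(2,4) dual_uminus[OF lamD] ml(2) _ that]) (use mN xy in auto)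
  have "N (y / x) = 1" using norm_divide[OF xyK(2,1) xy(3)] norm_nonzero[OF xyK(1) xy(3)] xy(5,6) by simp
  then have unit: "y / x \<in> unit_grp"
    unfolding unit_grp_def using pos D1 D2 xyK by (simp add: K_closed)
  \<comment> \<open>Ratio 1 would make the quotient rational, with cube equal to its norm 1; but it
    was chosen larger than 1, which is the purpose of the 1 in \<open>max M 1\<close>.\<close>
  have "ratio (y / x) \<noteq> 1"
  proof
    assume "ratio (y / x) = 1"
    then have "\<sigma> (y / x) = \<tau> (y / x)" unfolding ratio_def
      using conj_nonzero(2)[of "y / x"] xyK xy by (simp add: K_closed)
    then have "y / x \<in> \<rat>" by (rule rational_if_conjugates_eq[OF unit_grp_K[OF unit]])
    then have "(y / x) ^ 3 = 1" using norm_rat[of "y / x"] unit_grp_norm[OF unit] by metis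
    moreover have "1 < (y / x) ^ 3" using ugt by (intro one_less_power) auto
    ultimately show False by simp
  qed
  moreover have "norm (ratio (y / x) - 1) < \<epsilon>"
  proof -
    have xr: "1 \<le> B * norm (ratio x)" unfolding x_def by (rule rat(2)[OF rpos])
    then have nz: "ratio x \<noteq> 0" by auto
    have "ratio (y / x) - 1 = (ratio y - ratio x) / ratio x"
      using ratio_divide[OF xyK(2,1) xy(3)] nz by (simp add: field_simps)
    then have "norm (ratio (y / x) - 1) * norm (ratio x) = dist (ratio y) (ratio x)"
      using nz by (simp add: Real_Vector_Spaces.norm_divide dist_norm)
    also have "\<dots> < \<epsilon> / B" unfolding x_def y_def using k1 l(2) by simp
    also have "\<dots> \<le> \<epsilon> * norm (ratio x)" using xr B eps by (simp add: divide_le_eq mult_ac)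
    finally show ?thesis using nz by simp
  qed
  ultimately show ?thesis using unit ugt by (intro bexI[of _ "y / x"]) auto
qed

end

section \<open>Density of the ratio of conjugates of units\<close>

context cubic_conjugates begin

text \<open>Each factor \<open>w\<close> advances the ratio by \<open>\<delta>\<close> along the
  one-parameter group \<open>E\<close>, and the integer part of \<open>t / \<delta>\<close> is the
  number of steps that ends within one step of the target. At least one factor \<open>w\<close>
  occurs because of \<open>t / \<delta> \<ge> 1\<close>, and this makes the resulting unit
  large.\<close>

lemma ratio_dense_step:
  fixes E :: "real \<Rightarrow> complex"
  assumes E: "\<And>a b. E (a + b) = E a * E b" "E 0 = 1"
    and v: "v \<in> unit_grp" "ratio v * E t = T" and w: "w \<in> unit_grp" "ratio w = E \<delta>" "\<delta> \<noteq> 0" "w > 1"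
    and t: "t / \<delta> \<ge> 1"
  shows "\<exists>u \<in> unit_grp. v * w \<le> u \<and> (\<exists>h. \<bar>h\<bar> \<le> \<bar>\<delta>\<bar> \<and> ratio u = T * E h)"
proof -
  define n where "n = nat \<lfloor>t / \<delta>\<rfloor>"
  have n1: "n \<ge> 1" unfolding n_def using t by (simp add: le_nat_iff)
  have n2: "real n \<le> t / \<delta>" "t / \<delta> < real n + 1" unfolding n_def using t by linarith+
  have u: "v * w ^ n \<in> unit_grp" by (intro unit_grp_mult unit_grp_power v w)
  have En: "E (real k * \<delta>) = E \<delta> ^ k" for k
  proof (induction k)
    case (Suc k)
    have "E (real (Suc k) * \<delta>) = E (\<delta> + real k * \<delta>)" by (simp add: algebra_simps)
    then show ?case by (simp only: E Suc power_Suc)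
  qed (simp add: E)
  define h where "h = real n * \<delta> - t"
  have "ratio (v * w ^ n) = ratio v * E \<delta> ^ n"
    using ratio_mult[of v "w ^ n"] ratio_power[OF w(1)] unit_grp_K unit_grp_power v w by simp
  also have "\<dots> = ratio v * E (t + h)" unfolding En[symmetric] h_def by simp
  also have "\<dots> = T * E h" unfolding E v(2)[symmetric] by simp
  finally have r: "ratio (v * w ^ n) = T * E h" .
  have "\<bar>real n - t / \<delta>\<bar> \<le> 1" using n2 by linarith
  then have "\<bar>real n - t / \<delta>\<bar> * \<bar>\<delta>\<bar> \<le> 1 * \<bar>\<delta>\<bar>" by (intro mult_right_mono) auto
  moreover have "(real n - t / \<delta>) * \<delta> = h" unfolding h_def using w(3) by (simp add: algebra_simps)
  ultimately have "\<bar>h\<bar> \<le> \<bar>\<delta>\<bar>" by (metis abs_mult mult_1)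
  moreover have "w ^ 1 \<le> w ^ n" using n1 w(4) by (intro power_increasing) auto
  then have "v * w \<le> v * w ^ n" using unit_grp_pos[OF v(1)] by simp
  ultimately show ?thesis using u r by blast
qed

text \<open>Here \<open>E\<close> stands for \<open>cis\<close> or for the real exponential. The
  sign of the small step \<open>\<delta>\<close> cannot be prescribed, so two starting units are
  supplied, one with the target ahead and one with the target behind, and the one that agrees with
  the sign of \<open>\<delta>\<close> is used.\<close>

lemma ratio_dense_general:
  fixes E :: "real \<Rightarrow> complex"
  assumes E: "\<And>a b. E (a + b) = E a * E b" "E 0 = 1" "isCont E 0"
    and small: "\<And>\<eta> M. \<eta> > 0 \<Longrightarrow> \<exists>w\<in>unit_grp. M < w \<and> (\<exists>\<delta>. ratio w = E \<delta> \<and> \<delta> \<noteq> 0 \<and> \<bar>\<delta>\<bar> < \<eta>)"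
    and v1: "v1 \<in> unit_grp" "ratio v1 * E t1 = T" "t1 \<ge> 1"
    and v2: "v2 \<in> unit_grp" "ratio v2 * E t2 = T" "t2 \<le> -1"
    and eps: "\<epsilon> > 0"
  shows "\<exists>u \<in> unit_grp. M < u \<and> norm (ratio u - T) < \<epsilon>"
proof -
  have "\<epsilon> / (norm T + 1) > 0" using eps by (simp add: add_nonneg_pos)
  then obtain \<eta> where eta: "\<eta> > 0" "\<And>h. dist h 0 < \<eta> \<Longrightarrow> dist (E h) (E 0) < \<epsilon> / (norm T + 1)"
    using E(3) unfolding continuous_at_eps_delta by blast
  \<comment> \<open>The step is kept below 1 because the targets are at distance at least 1, so that
    at least one step is taken; \<open>w\<close> exceeds both quotients so that already
    \<open>v1 * w\<close> and \<open>v2 * w\<close> are larger than \<open>M\<close>.\<close>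
  obtain w \<delta> where w: "w \<in> unit_grp" "max 1 (max (M / v1) (M / v2)) < w" "ratio w = E \<delta>" "\<delta> \<noteq> 0" "\<bar>\<delta>\<bar> < min \<eta> 1"
    using small[of "min \<eta> 1" "max 1 (max (M / v1) (M / v2))"] eta(1) by auto
  have vp: "v1 > 0" "v2 > 0" using unit_grp_pos v1 v2 by auto
  have M: "M < v1 * w" "M < v2 * w" using w(2) vp by (simp_all add: divide_less_eq mult.commute)
  have "\<exists>u \<in> unit_grp. M < u \<and> (\<exists>h. \<bar>h\<bar> \<le> \<bar>\<delta>\<bar> \<and> ratio u = T * E h)"
  proof (cases "\<delta> > 0")
    case True
    then have "t1 / \<delta> \<ge> 1" using v1(3) w(5) by (simp add: le_divide_eq)
    then show ?thesis
      using ratio_dense_step[OF E(1,2) v1(1,2) w(1,3,4)] w(2) M(1) by (meson less_le_trans max_less_iff_conj)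
  next
    case False
    then have "t2 / \<delta> \<ge> 1" using v2(3) w(4,5) by (simp add: le_divide_eq)
    then show ?thesis
      using ratio_dense_step[OF E(1,2) v2(1,2) w(1,3,4)] w(2) M(2) by (meson less_le_trans max_less_iff_conj)
  qed
  then obtain u h where u: "u \<in> unit_grp" "M < u" "\<bar>h\<bar> \<le> \<bar>\<delta>\<bar>" "ratio u = T * E h" by blast
  have "dist (E h) (E 0) < \<epsilon> / (norm T + 1)" using u(3) w(5) by (intro eta) (simp add: dist_norm)
  then have "norm (E h - 1) * (norm T + 1) < \<epsilon>"
    using E(2) by (simp add: dist_norm pos_less_divide_eq add_nonneg_pos)
  moreover have "norm (ratio u - T) \<le> norm (E h - 1) * (norm T + 1)"
  proof -
    have "ratio u - T = (E h - 1) * T" unfolding u(4) by (simp add: algebra_simps)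
    then have "norm (ratio u - T) = norm (E h - 1) * norm T" by (simp add: Real_Vector_Spaces.norm_mult)
    also have "\<dots> \<le> norm (E h - 1) * (norm T + 1)" by (intro mult_left_mono) auto
    finally show ?thesis .
  qed
  ultimately show ?thesis using u by (intro bexI[of _ u]) auto
qed

text \<open>All ratios lie on the unit circle. Since the circle closes up, the trivial unit serves
  as both starting points: the target is reached at its argument shifted by a full turn forwards or
  backwards.\<close>

lemma ratio_dense_complex:
  assumes c: "\<And>x. x \<in> K \<Longrightarrow> \<tau> x = cnj (\<sigma> x)" and T: "norm T = 1" and eps: "\<epsilon> > 0"
  shows "\<exists>u \<in> unit_grp. M < u \<and> norm (ratio u - T) < \<epsilon>"
proof (rule ratio_dense_general[where E = cis])
  show "cis (a + b) = cis a * cis b" for a b by (simp add: cis_mult)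
  show "isCont cis 0" using continuous_on_cis[OF continuous_on_id, of UNIV] by (simp add: continuous_on_eq_continuous_at)
  have A: "cis (Arg z) = z" if "norm z = 1" for z
    using that cis_Arg[of z] by (cases "z = 0") (auto simp: sgn_eq)
  show "ratio 1 * cis (Arg T + 2 * pi) = T" "ratio 1 * cis (Arg T - 2 * pi) = T"
    using A[OF T] by (simp_all add: ratio_one cis_mult[symmetric] cis_divide[symmetric])
  show "Arg T + 2 * pi \<ge> 1" "Arg T - 2 * pi \<le> -1" using Arg_bounded[of T] pi_gt3 by linarith+
  fix \<eta> M :: real assume eta: "\<eta> > 0"
  have "isCont Arg 1" by (rule continuous_at_Arg) simp
  then obtain e where e: "e > 0" "\<And>z. dist z 1 < e \<Longrightarrow> dist (Arg z) (Arg 1) < \<eta>"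
    using eta unfolding continuous_at_eps_delta by blast
  obtain w where w: "w \<in> unit_grp" "M < w" "ratio w \<noteq> 1" "norm (ratio w - 1) < e"
    using unit_small_ratio[OF e(1)] by blast
  have "w \<noteq> 0" using unit_grp_pos[OF w(1)] by simp
  then have "norm (ratio w) = 1"
    unfolding ratio_def c[OF unit_grp_K[OF w(1)]] using conj_nonzero(1)[OF unit_grp_K[OF w(1)]]
    by (simp add: Real_Vector_Spaces.norm_divide)
  then have "cis (Arg (ratio w)) = ratio w" by (rule A)
  moreover from this w(3) have "Arg (ratio w) \<noteq> 0" by (metis cis_zero)
  moreover have "\<bar>Arg (ratio w)\<bar> < \<eta>" using e(2)[of "ratio w"] w(4) by (simp add: dist_norm)
  ultimately show "\<exists>w\<in>unit_grp. M < w \<and> (\<exists>\<delta>. ratio w = cis \<delta> \<and> \<delta> \<noteq> 0 \<and> \<bar>\<delta>\<bar> < \<eta>)"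
    using w(1,2) by metis
qed (use unit_grp_one eps in auto)

text \<open>The ratio of a unit is positive, because \<open>w * p * q = 1\<close> with
  \<open>w\<close> positive gives its two real conjugates the same sign. On the multiplicative
  half-line a target does not recur, so the two starting units are high powers of units with ratio
  above and below 1, which come from one nontrivial unit and its inverse.\<close>

lemma ratio_dense_real:
  assumes c: "\<And>x. x \<in> K \<Longrightarrow> \<sigma> x \<in> \<real> \<and> \<tau> x \<in> \<real>" and T: "T = of_real (exp t)" and eps: "\<epsilon> > 0"
  shows "\<exists>u \<in> unit_grp. M < u \<and> norm (ratio u - T) < \<epsilon>"
proof -
  define E where "E x = complex_of_real (exp x)" for x
  have E: "E (a + b) = E a * E b" "E 0 = 1" "isCont E 0" for a b
    unfolding E_def by (simp_all add: exp_add)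
  have rE: "\<exists>\<delta>. ratio w = E \<delta> \<and> \<delta> = ln (Re (ratio w))" if w: "w \<in> unit_grp" for w
  proof -
    note wK = unit_grp_K[OF w] and wp = unit_grp_pos[OF w]
    obtain p q where pq: "\<sigma> w = of_real p" "\<tau> w = of_real q" using c[OF wK] by (auto elim!: Reals_cases)
    have "complex_of_real 1 = of_real (w * p * q)"
      using trace_norm_conjugates(2)[OF wK] unit_grp_norm[OF w] pq by simp
    then have "w * p * q = 1" by (simp only: of_real_eq_iff)
    then have "p * q > 0" using wp by (metis zero_less_mult_pos mult.assoc zero_less_one)
    then have "p / q > 0" by (simp add: zero_less_mult_iff zero_less_divide_iff)
    moreover have "ratio w = of_real (p / q)" unfolding ratio_def pq by simp
    ultimately show ?thesis unfolding E_def by simp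
  qed
  have small: "\<exists>w\<in>unit_grp. M < w \<and> (\<exists>\<delta>. ratio w = E \<delta> \<and> \<delta> \<noteq> 0 \<and> \<bar>\<delta>\<bar> < \<eta>)" if eta: "\<eta> > 0" for \<eta> M
  proof -
    have "isCont (\<lambda>z. ln (Re z)) 1" by (intro continuous_intros) auto
    then obtain e where e: "e > 0" "\<And>z. dist z 1 < e \<Longrightarrow> dist (ln (Re z)) (ln (Re 1)) < \<eta>"
      using eta unfolding continuous_at_eps_delta by blast
    obtain w where w: "w \<in> unit_grp" "M < w" "ratio w \<noteq> 1" "norm (ratio w - 1) < e"
      using unit_small_ratio[OF e(1)] by blast
    obtain \<delta> where d: "ratio w = E \<delta>" "\<delta> = ln (Re (ratio w))" using rE[OF w(1)] by blast
    have "\<delta> \<noteq> 0" using d(1) w(3) E(2) by auto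
    moreover have "\<bar>\<delta>\<bar> < \<eta>" using e(2)[of "ratio w"] w(4) unfolding d(2) by (simp add: dist_norm)
    ultimately show ?thesis using w d(1) by blast
  qed
  obtain w0 \<delta>0 where w0: "w0 \<in> unit_grp" "ratio w0 = E \<delta>0" "\<delta>0 \<noteq> 0" using small[of 1 0] by auto
  have inv: "1 / w0 \<in> unit_grp" "ratio (1 / w0) = E (- \<delta>0)"
  proof -
    show "1 / w0 \<in> unit_grp" by (rule unit_grp_inverse[OF w0(1)])
    have "ratio (1 / w0) = 1 / E \<delta>0"
      using ratio_divide[of 1 w0] ratio_one unit_grp_K[OF w0(1)] unit_grp_pos[OF w0(1)] w0(2) by (simp add: K_closed)
    then show "ratio (1 / w0) = E (- \<delta>0)" unfolding E_def by (simp add: exp_minus field_simps)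
  qed
  obtain w1 \<delta>1 where w1: "w1 \<in> unit_grp" "ratio w1 = E \<delta>1" "\<delta>1 > 0"
    using that[OF w0(1,2)] that[OF inv] w0(3) by (metis linorder_neqE_linordered_idom neg_0_less_iff_less)
  obtain w2 \<delta>2 where w2: "w2 \<in> unit_grp" "ratio w2 = E (- \<delta>2)" "\<delta>2 > 0"
    using that[OF w0(1), of "- \<delta>0"] that[OF inv] w0(2,3)
    by (metis linorder_neqE_linordered_idom minus_minus neg_0_less_iff_less)
  have En: "E x ^ n = E (real n * x)" for x n
    unfolding E_def by (simp add: exp_of_nat_mult)
  \<comment> \<open>The exponents are large enough to put the target at least 1 ahead of the power
    of \<open>w2\<close> and at least 1 behind the power of \<open>w1\<close>.\<close>
  obtain n2 where n2: "1 - t < real n2 * \<delta>2" using reals_Archimedean3[OF w2(3)] by blast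
  obtain n1 where n1: "t + 1 < real n1 * \<delta>1" using reals_Archimedean3[OF w1(3)] by blast
  show ?thesis
  proof (rule ratio_dense_general[where E = E and ?v1.0 = "w2 ^ n2" and ?t1.0 = "t + real n2 * \<delta>2"
        and ?v2.0 = "w1 ^ n1" and ?t2.0 = "t - real n1 * \<delta>1"])
    show "w2 ^ n2 \<in> unit_grp" "w1 ^ n1 \<in> unit_grp" using w1 w2 unit_grp_power by auto
    show "ratio (w2 ^ n2) * E (t + real n2 * \<delta>2) = T" "ratio (w1 ^ n1) * E (t - real n1 * \<delta>1) = T"
      unfolding ratio_power[OF w1(1)] ratio_power[OF w2(1)] w1(2) w2(2) En E(1)[symmetric]
      by (simp_all add: E_def T)
    show "t + real n2 * \<delta>2 \<ge> 1" "t - real n1 * \<delta>1 \<le> -1" using n1 n2 by linarith+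
  qed (use E small eps in auto)
qed

section \<open>From density of ratios to entire level curves\<close>

lemma crd_real:
  assumes c: "\<And>x. x \<in> K \<Longrightarrow> \<sigma> x \<in> \<real> \<and> \<tau> x \<in> \<real>"
  shows "crdX v \<in> \<real>" "crdY v \<in> \<real>"
  unfolding crdX_def crdY_def disc_root_def
  using c[OF Kset_gens(1)] c[OF Kset_gens(2)] by (auto intro!: Reals_divide Reals_diff Reals_mult)

text \<open>Complex conjugation exchanges the numerators of \<open>crdX\<close> and
  \<open>crdY\<close> up to sign and negates \<open>disc_root\<close>; the signs cancel.\<close>

lemma crd_cnj:
  assumes c: "\<And>x. x \<in> K \<Longrightarrow> \<tau> x = cnj (\<sigma> x)"
  shows "crdY v = cnj (crdX v)"
proof -
  have "cnj disc_root = - disc_root"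
    unfolding disc_root_def c[OF Kset_gens(1)] c[OF Kset_gens(2)] by (simp add: algebra_simps)
  then show ?thesis
    unfolding crdX_def crdY_def c[OF Kset_gens(1)] c[OF Kset_gens(2)]
    by (simp add: minus_divide_left[symmetric] divide_minus_right[symmetric] del: divide_minus_right)
       (simp add: minus_divide_left)
qed

text \<open>The approximating elements are \<open>s * u\<close> up to sign, with \<open>u\<close> a
  large unit. Their weighted conjugates have the exact product \<open>x * y\<close>, so only the
  first coordinate has to converge; the ratio controls its square, and the sign is then
  chosen.\<close>

lemma snorm_A_half:
  assumes s: "s \<in> D" "s \<noteq> 0" and v: "crdX v * crdY v = of_real (snorm s)"
  shows "v \<in> A_half a1 a2"
proof -
  have sK: "s \<in> K" using s dual_K by blast
  define x y where "x = crdX v" and "y = crdY v"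
  have xy: "x * y = of_real (snorm s)" unfolding x_def y_def by (rule v)
  have sn: "of_real (snorm s) = of_real \<bar>s\<bar> * \<sigma> s * \<tau> s" by (rule snorm_conjugates[OF sK])
  have snz: "\<sigma> s \<noteq> 0" "\<tau> s \<noteq> 0" using conj_nonzero[OF sK s(2)] by auto
  have "x * y \<noteq> 0" unfolding xy sn using snz s(2) by simp
  then have nz: "x \<noteq> 0" "y \<noteq> 0" by auto
  \<comment> \<open>The ratio of \<open>s * u\<close> is \<open>ratio s * ratio u\<close> and has to
    tend to \<open>x / y\<close>; this is the limit thereby required of
    \<open>ratio u\<close>.\<close>
  define T where "T = x / y / ratio s"
  have dense: "\<exists>u \<in> unit_grp. M < u \<and> norm (ratio u - T) < e" if e: "e > 0" for M e
    using conj
  proof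
    assume r: "\<forall>x\<in>K. \<sigma> x \<in> \<real> \<and> \<tau> x \<in> \<real>"
    obtain p q where pq: "\<sigma> s = of_real p" "\<tau> s = of_real q" using r sK by (auto elim!: Reals_cases)
    obtain x' y' where xy': "x = of_real x'" "y = of_real y'"
      using crd_real[of v] r unfolding x_def y_def by (auto elim!: Reals_cases)
    have "complex_of_real (x' * y') = of_real (\<bar>s\<bar> * p * q)"
      using xy sn unfolding pq xy' by simp
    then have e1: "x' * y' = \<bar>s\<bar> * p * q" by (simp only: of_real_eq_iff)
    have nz': "p \<noteq> 0" "q \<noteq> 0" "x' \<noteq> 0" "y' \<noteq> 0" using snz nz unfolding pq xy' by auto
    \<comment> \<open>Ratios of units are positive, so the target must be shown positive:
      \<open>x' * y'\<close> and \<open>p * q\<close> have the same sign because they differ by the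
      factor \<open>\<bar>s\<bar>\<close>.\<close>
    have "x' / y' / (p / q) = (x' * y') * (p * q) / (y' * p)\<^sup>2"
      using nz' by (simp add: power2_eq_square)
    also have "\<dots> = \<bar>s\<bar> * (p * q)\<^sup>2 / (y' * p)\<^sup>2"
      unfolding e1 by (simp add: power2_eq_square)
    also have "\<dots> > 0" using nz' s(2) by simp
    finally have "x' / y' / (p / q) > 0" .
    moreover have "T = of_real (x' / y' / (p / q))"
      unfolding T_def ratio_def pq xy' by simp
    ultimately have "T = of_real (exp (ln (x' / y' / (p / q))))" by simp
    then show ?thesis using ratio_dense_real[of T "ln (x' / y' / (p / q))" e M] r e by blast
  next
    assume c: "\<forall>x\<in>K. \<tau> x = cnj (\<sigma> x)"
    have "y = cnj x" unfolding x_def y_def using crd_cnj c by blast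
    moreover have "\<tau> s = cnj (\<sigma> s)" using c sK by blast
    ultimately have "norm T = 1"
      unfolding T_def ratio_def using nz snz by (simp add: Real_Vector_Spaces.norm_divide Real_Vector_Spaces.norm_mult)
    then show ?thesis using ratio_dense_complex[of T e M] c e by blast
  qed
  have "\<exists>u. u \<in> unit_grp \<and> real k < u \<and> norm (ratio u - T) < inverse (real (Suc k))" for k
    using dense[of "inverse (real (Suc k))" "real k"] by auto
  then obtain u where u: "\<And>k. u k \<in> unit_grp" "\<And>k. real k < u k" "\<And>k. norm (ratio (u k) - T) < inverse (real (Suc k))"
    by metis
  have uK: "u k \<in> K" and upos: "u k > 0" for k using unit_grp_K unit_grp_pos u(1) by auto
  have "(\<lambda>k. ratio (u k) - T) \<longlonglongrightarrow> 0"
    by (rule Lim_null_comparison[OF always_eventually LIMSEQ_inverse_real_of_nat], rule allI)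
      (rule less_imp_le[OF u(3)])
  then have ru: "(\<lambda>k. ratio (u k)) \<longlonglongrightarrow> T" by (rule LIM_zero_cancel)
  define z where "z a = of_real (sqrt \<bar>a\<bar>) * \<sigma> a" for a
  define z' where "z' a = of_real (sqrt \<bar>a\<bar>) * \<tau> a" for a
  have zz: "z a * z' a = of_real (snorm a)" if "a \<in> K" for a
  proof -
    have "z a * z' a = complex_of_real (sqrt \<bar>a\<bar> * sqrt \<bar>a\<bar>) * \<sigma> a * \<tau> a"
      unfolding z_def z'_def by (simp only: of_real_mult mult_ac)
    then show ?thesis using snorm_conjugates[OF that] by simp
  qed
  have su: "s * u k \<in> D" "s * u k \<in> K" "s * u k \<noteq> 0" for k
    using unit_grp_dual[OF u(1) s(1)] dual_K s(2) upos[of k] by auto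
  have snu: "snorm (s * u k) = snorm s" for k
    unfolding snorm_def using norm_mult[OF sK uK] unit_grp_norm[OF u(1)] upos[of k] by (simp add: sgn_mult)
  \<comment> \<open>Of the two square roots the one nearer to \<open>x\<close> is taken; passing to
    \<open>- (s * u)\<close> negates both weighted conjugates and leaves their product
    alone.\<close>
  define \<xi> where "\<xi> k = (if norm (z (s * u k) - x) \<le> norm (z (s * u k) + x) then s * u k else - (s * u k))" for k
  have xiD: "\<xi> k \<in> D" for k unfolding \<xi>_def using su(1) dual_uminus by simp
  have zneg: "z (- a) = - z a" "z' (- a) = - z' a" if "a \<in> K" for a
    unfolding z_def z'_def using embedding_uminus[OF emb(1) that] embedding_uminus[OF emb(2) that] by simp_all
  have zxi: "z (\<xi> k) * z' (\<xi> k) = x * y" for k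
    unfolding xy using zz[OF su(2)] snu zneg[OF su(2)] unfolding \<xi>_def by simp
  \<comment> \<open>The difference of squares is the product of the distances to \<open>x\<close>
    and to \<open>- x\<close>, and the chosen sign makes the remaining distance the smaller of the
    two.\<close>
  have sq: "norm (z (\<xi> k) - x) ^ 2 \<le> norm (z (s * u k) ^ 2 - x ^ 2)" for k
  proof -
    have "z (s * u k) ^ 2 - x ^ 2 = (z (s * u k) - x) * (z (s * u k) + x)"
      by (simp add: power2_eq_square algebra_simps)
    then have n: "norm (z (s * u k) ^ 2 - x ^ 2) = norm (z (s * u k) - x) * norm (z (s * u k) + x)"
      by (simp add: Real_Vector_Spaces.norm_mult)
    show ?thesis
    proof (cases "norm (z (s * u k) - x) \<le> norm (z (s * u k) + x)")
      case True
      then show ?thesis unfolding n \<xi>_def by (simp add: power2_eq_square mult_left_mono)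
    next
      case False
      have "norm (- z (s * u k) - x) = norm (z (s * u k) + x)"
        using norm_minus_cancel[of "z (s * u k) + x"] by simp
      then show ?thesis using False unfolding n \<xi>_def by (simp add: power2_eq_square mult_right_mono zneg[OF su(2)])
    qed
  qed
  have "z (s * u k) ^ 2 = x * y * (ratio s * ratio (u k))" for k
  proof -
    have "z (s * u k) = z' (s * u k) * ratio (s * u k)"
      unfolding z_def z'_def ratio_def using conj_nonzero(2)[OF su(2,3)] by simp
    then have "z (s * u k) ^ 2 = (z (s * u k) * z' (s * u k)) * ratio (s * u k)"
      by (simp add: power2_eq_square mult_ac)
    then show ?thesis unfolding zz[OF su(2)] snu xy ratio_mult[OF sK uK] .
  qed
  moreover have "(\<lambda>k. x * y * (ratio s * ratio (u k))) \<longlonglongrightarrow> x * y * (ratio s * T)"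
    by (intro tendsto_intros ru)
  moreover have "x * y * (ratio s * T) = x ^ 2"
    unfolding T_def using nz snz unfolding ratio_def by (simp add: power2_eq_square)
  ultimately have "(\<lambda>k. z (s * u k) ^ 2) \<longlonglongrightarrow> x ^ 2" by simp
  then have "(\<lambda>k. norm (z (s * u k) ^ 2 - x ^ 2)) \<longlonglongrightarrow> 0" by (intro tendsto_norm_zero LIM_zero)
  then have "(\<lambda>k. norm (z (\<xi> k) - x) ^ 2) \<longlonglongrightarrow> 0"
    by (rule Lim_null_comparison[rotated]) (use sq in \<open>auto intro!: always_eventually\<close>)
  then have "(\<lambda>k. sqrt (norm (z (\<xi> k) - x) ^ 2)) \<longlonglongrightarrow> sqrt 0" by (rule tendsto_real_sqrt)
  then have zl: "(\<lambda>k. z (\<xi> k)) \<longlonglongrightarrow> x"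
    by (simp add: tendsto_norm_zero_iff LIM_zero_iff)
  have "(\<lambda>k. x * y / z (\<xi> k)) \<longlonglongrightarrow> x * y / x" by (intro tendsto_intros zl nz)
  moreover have "x * y / z (\<xi> k) = z' (\<xi> k)" for k
  proof -
    have "z (\<xi> k) \<noteq> 0" using zxi[of k] nz by auto
    then show ?thesis unfolding zxi[of k, symmetric] by simp
  qed
  ultimately have zl': "(\<lambda>k. z' (\<xi> k)) \<longlonglongrightarrow> y" using nz by simp
  have "\<bar>\<xi> k\<bar> = \<bar>s\<bar> * u k" for k unfolding \<xi>_def using upos[of k] by (simp add: abs_mult)
  moreover have "filterlim (\<lambda>k. \<bar>s\<bar> * u k) at_top sequentially"
    by (rule filterlim_tendsto_pos_mult_at_top[OF tendsto_const])
       (use s(2) u(2) in \<open>auto intro!: filterlim_at_top_mono[OF filterlim_real_sequentially] always_eventually less_imp_le\<close>)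
  ultimately have "filterlim (\<lambda>k. \<bar>\<xi> k\<bar>) at_top sequentially" by simp
  then show ?thesis
    unfolding A_half_seq using xiD zl zl' unfolding z_def z'_def x_def y_def by blast
qed

lemma A_half_eq: "A_half a1 a2 = {v. \<exists>s \<in> D - {0}. crdX v * crdY v = of_real (snorm s)}"
  using A_half_snorm snorm_A_half by blast

end

section \<open>The conics\<close>

lemma qform_scale: "qform a b c (r *\<^sub>R v) = r\<^sup>2 * qform a b c v"
  unfolding qform_def by (simp add: power2_eq_square algebra_simps)

lemma dilate_qform:
  assumes "r > 0"
  shows "dilate r {v. qform a b c v = k} = {v. qform a b c v = k * r\<^sup>2}"
proof (intro set_eqI iffI)
  fix v assume "v \<in> {v. qform a b c v = k * r\<^sup>2}"
  then have "qform a b c ((1 / r) *\<^sub>R v) = k" unfolding qform_scale using assms by (simp add: power_divide)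
  moreover have "v = r *\<^sub>R ((1 / r) *\<^sub>R v)" using assms by simp
  ultimately show "v \<in> dilate r {v. qform a b c v = k}" unfolding dilate_def by blast
next
  fix v assume "v \<in> dilate r {v. qform a b c v = k}"
  then obtain w where "v = r *\<^sub>R w" "qform a b c w = k" unfolding dilate_def by blast
  then show "v \<in> {v. qform a b c v = k * r\<^sup>2}" by (simp add: qform_scale del: scaleR_Pair)
qed

text \<open>The map is half the gradient of the form, turned by a right angle and divided by
  \<open>\<delta>\<close>. Its matrix has trace 0 and determinant -1, so it is an involution, and it
  negates the form.\<close>

lemma conjugate_hyperbola:
  assumes "a * c - b\<^sup>2 < 0"
  shows "\<exists>J. linear J \<and> J ` {v. qform a b c v = 1} = {v. qform a b c v = -1}"
proof -
  define \<delta> where "\<delta> = sqrt (b\<^sup>2 - a * c)"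
  have d: "\<delta> > 0" "\<delta> * \<delta> = b * b - a * c"
    unfolding \<delta>_def using assms by (simp_all add: power2_eq_square)
  define J where "J v = ((b * fst v + c * snd v) / \<delta>, (- a * fst v - b * snd v) / \<delta>)" for v :: "real \<times> real"
  have lin: "linear J"
    by (rule linearI) (simp_all add: J_def add_divide_distrib diff_divide_distrib algebra_simps)
  have Q: "qform a b c (J v) = - qform a b c v" for v
  proof -
    have "J v = (1 / \<delta>) *\<^sub>R (b * fst v + c * snd v, - a * fst v - b * snd v)"
      by (simp add: J_def)
    then have "qform a b c (J v) = (1 / \<delta>)\<^sup>2 * qform a b c (b * fst v + c * snd v, - a * fst v - b * snd v)"
      by (simp only: qform_scale)
    also have "\<dots> = (a * (b * fst v + c * snd v)\<^sup>2 + 2 * b * (b * fst v + c * snd v) * (- a * fst v - b * snd v)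
        + c * (- a * fst v - b * snd v)\<^sup>2) / (\<delta> * \<delta>)"
      unfolding qform_def by (simp add: power2_eq_square)
    also have "\<dots> = - qform a b c v * (b * b - a * c) / (\<delta> * \<delta>)"
      unfolding qform_def by (simp add: power2_eq_square algebra_simps)
    also have "\<dots> = - qform a b c v"
      unfolding d(2)[symmetric] using d(1) by simp
    finally show ?thesis .
  qed
  have JJ: "J (J v) = v" for v
  proof -
    have "J (J v) = ((b * b - a * c) * fst v / (\<delta> * \<delta>), (b * b - a * c) * snd v / (\<delta> * \<delta>))"
      unfolding J_def by (simp add: algebra_simps add_divide_distrib diff_divide_distrib)
    then show ?thesis unfolding d(2)[symmetric] using d(1) by simp
  qed
  have "J ` {v. qform a b c v = 1} = {v. qform a b c v = -1}"
  proof (intro set_eqI iffI)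
    fix v assume "v \<in> {v. qform a b c v = -1}"
    then have "J v \<in> {v. qform a b c v = 1}" by (simp add: Q)
    then show "v \<in> J ` {v. qform a b c v = 1}" using JJ[of v] by (metis image_eqI)
  qed (auto simp: Q)
  then show ?thesis using lin by blast
qed

context cubic_conjugates begin

lemma crd_zero: "crdX v = 0 \<Longrightarrow> crdY v = 0 \<Longrightarrow> v = 0"
  using crd_recover[of v] by (simp add: prod_eq_iff)

lemma crd_linear:
  "crdX v = crdX (1, 0) * of_real (fst v) + crdX (0, 1) * of_real (snd v)"
  "crdY v = crdY (1, 0) * of_real (fst v) + crdY (0, 1) * of_real (snd v)"
  unfolding crdX_def crdY_def using disc_root_nonzero by (simp_all add: field_simps)

lemma abs_snorm: "s \<noteq> 0 \<Longrightarrow> \<bar>snorm s\<bar> = \<bar>N s\<bar>"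
  unfolding snorm_def by (simp add: abs_mult)

lemma snorm_nonzero: "s \<in> D - {0} \<Longrightarrow> snorm s \<noteq> 0"
  using abs_snorm[of s] norm_nonzero[of s] dual_K[of s] by auto

text \<open>The form is homogeneous of degree 2, so dilation by the square root of the absolute norm
  leaves only the sign of the level.\<close>

lemma level_set_eq_dilate:
  assumes "s \<in> D - {0}"
  shows "{v. qform a b c v = snorm s} = dilate (sqrt \<bar>N s\<bar>) {v. qform a b c v = sgn (snorm s)}"
proof -
  have "\<bar>N s\<bar> > 0" using snorm_nonzero[OF assms] abs_snorm[of s] assms by auto
  then have "dilate (sqrt \<bar>N s\<bar>) {v. qform a b c v = sgn (snorm s)} = {v. qform a b c v = sgn (snorm s) * \<bar>N s\<bar>}"
    by (subst dilate_qform) auto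
  then show ?thesis using abs_snorm[of s] assms by (metis DiffD2 insertI1 mult.commute abs_mult_sgn)
qed

lemma A_half_level_sets:
  assumes "\<And>v. crdX v * crdY v = of_real (qform a b c v)"
  shows "A_half a1 a2 = (\<Union>s \<in> D - {0}. dilate (sqrt \<bar>N s\<bar>) {v. qform a b c v = sgn (snorm s)})"
proof -
  have "A_half a1 a2 = (\<Union>s \<in> D - {0}. {v. qform a b c v = snorm s})"
    unfolding A_half_eq assms of_real_eq_iff by blast
  then show ?thesis using level_set_eq_dilate by simp
qed

text \<open>The form X Y is the squared modulus of X, hence positive definite, and the signed norm
  is positive for the same reason; so one ellipse serves every \<open>s\<close>.\<close>

lemma A_half_complex:
  assumes c: "\<And>x. x \<in> K \<Longrightarrow> \<tau> x = cnj (\<sigma> x)"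
  shows "\<exists>E. is_ellipse E \<and> A_half a1 a2 = (\<Union>s \<in> D - {0}. dilate (sqrt \<bar>N s\<bar>) E)"
proof -
  define A B where "A = crdX (1, 0)" and "B = crdX (0, 1)"
  define a b c' where "a = (norm A)\<^sup>2" and "b = Re (A * cnj B)" and "c' = (norm B)\<^sup>2"
  have Y: "crdY v = cnj (crdX v)" for v using crd_cnj c by blast
  have zero: "v = 0" if "crdX v = 0" for v using that crd_zero[of v] Y[of v] by simp
  have form: "crdX v * crdY v = of_real (qform a b c' v)" for v
    unfolding Y crd_linear(1)[of v] A_def[symmetric] B_def[symmetric] qform_def a_def b_def c'_def
    by (simp add: complex_eq_iff cmod_power2) (simp add: power2_eq_square algebra_simps)
  have A0: "A \<noteq> 0" and B0: "B \<noteq> 0" using zero[of "(1, 0)"] zero[of "(0, 1)"] unfolding A_def B_def by (auto simp: zero_prod_def)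
  have disc: "a * c' - b\<^sup>2 = (Im (A * cnj B))\<^sup>2"
  proof -
    have "a * c' = (norm (A * cnj B))\<^sup>2"
      unfolding a_def c'_def by (simp add: Real_Vector_Spaces.norm_mult power_mult_distrib)
    then show ?thesis unfolding b_def cmod_power2 by simp
  qed
  \<comment> \<open>Otherwise \<open>A\<close> and \<open>B\<close> would be dependent over the
    reals, and the nonzero real vector \<open>(c', - b)\<close> would be annihilated by the
    injective map \<open>crdX\<close>.\<close>
  have "Im (A * cnj B) \<noteq> 0"
  proof
    assume "Im (A * cnj B) = 0"
    then have r: "A * cnj B = of_real b" unfolding b_def by (simp add: complex_eq_iff)
    have "B * cnj B = of_real c'" unfolding c'_def by (rule complex_norm_square[symmetric])
    then have "crdX (c', - b) = A * (B * cnj B) - B * (A * cnj B)"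
      unfolding crd_linear(1)[of "(c', - b)"] A_def[symmetric] B_def[symmetric] using r by simp
    then have "(c', - b) = 0" by (intro zero) (simp add: algebra_simps)
    then show False using B0 unfolding c'_def by (simp add: zero_prod_def)
  qed
  then have "a * c' - b\<^sup>2 > 0" unfolding disc by simp
  moreover have "a > 0" unfolding a_def using A0 by simp
  ultimately have "is_ellipse {v. qform a b c' v = 1}"
    unfolding is_ellipse_def by (intro exI[of _ a] exI[of _ b] exI[of _ c'] exI[of _ 0]) auto
  moreover have "sgn (snorm s) = 1" if "s \<in> D - {0}" for s
  proof -
    have sK: "s \<in> K" using that dual_K by blast
    have "complex_of_real (snorm s) = of_real (\<bar>s\<bar> * (norm (\<sigma> s))\<^sup>2)"
      unfolding snorm_conjugates[OF sK] c[OF sK] of_real_mult complex_norm_square by (simp add: mult.assoc)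
    then have "snorm s = \<bar>s\<bar> * (norm (\<sigma> s))\<^sup>2" by (simp only: of_real_eq_iff)
    then have "snorm s \<ge> 0" by simp
    then show ?thesis using snorm_nonzero[OF that] by simp
  qed
  ultimately show ?thesis using A_half_level_sets[OF form] by (intro exI[of _ "{v. qform a b c' v = 1}"]) auto
qed

text \<open>X Y is a product of two independent real linear forms and hence indefinite. The sign of
  \<open>snorm s\<close> decides between the hyperbola and its conjugate, and one and the same map
  \<open>J\<close> serves all \<open>s\<close> of negative sign.\<close>

lemma A_half_real:
  assumes r: "\<And>x. x \<in> K \<Longrightarrow> \<sigma> x \<in> \<real> \<and> \<tau> x \<in> \<real>"
  shows "\<exists>a b c (L :: real \<Rightarrow> real \<times> real \<Rightarrow> real \<times> real).
               a * c - b^2 < 0 \<and>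
               (\<forall>s \<in> D - {0}. L s = id \<or>
                  (linear (L s) \<and> L s ` {v. qform a b c v = 1} = {v. qform a b c v = -1})) \<and>
               A_half a1 a2 = (\<Union>s \<in> D - {0}. dilate (sqrt \<bar>N s\<bar>) (L s ` {v. qform a b c v = 1}))"
proof -
  obtain A B C E where crd: "crdX (1, 0) = of_real A" "crdX (0, 1) = of_real B"
      "crdY (1, 0) = of_real C" "crdY (0, 1) = of_real E"
    using crd_real[OF r] by (metis Reals_cases)
  define a b c where "a = A * C" and "b = (A * E + B * C) / 2" and "c = B * E"
  have X: "crdX v = of_real (A * fst v + B * snd v)" and Y: "crdY v = of_real (C * fst v + E * snd v)" for v
    unfolding crd_linear(1)[of v] crd_linear(2)[of v] crd by simp_all
  have form: "crdX v * crdY v = of_real (qform a b c v)" for v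
  proof -
    have "(A * fst v + B * snd v) * (C * fst v + E * snd v) = qform a b c v"
      unfolding qform_def a_def b_def c_def by (simp add: field_simps power2_eq_square)
    then show ?thesis unfolding X Y by (metis of_real_mult)
  qed
  have zero: "v = 0" if "A * fst v + B * snd v = 0" "C * fst v + E * snd v = 0" for v
    using crd_zero[of v] that unfolding X Y by simp
  have "A * E - B * C \<noteq> 0"
  proof
    assume eq: "A * E - B * C = 0"
    \<comment> \<open>If the determinant vanished, each of these vectors would be annihilated by
      both linear forms, so all coefficients would be 0.\<close>
    have "(B, - A) = 0" "(E, - C) = 0" using eq by (intro zero; simp add: algebra_simps)+
    then have "A = 0" "B = 0" "C = 0" "E = 0" by (auto simp: zero_prod_def)
    then show False using zero[of "(1, 0)"] by (simp add: zero_prod_def)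
  qed
  moreover have "a * c - b\<^sup>2 = - ((A * E - B * C) / 2)\<^sup>2"
    unfolding a_def b_def c_def by (simp add: power2_eq_square field_simps)
  ultimately have disc: "a * c - b\<^sup>2 < 0" by simp
  obtain J where J: "linear J" "J ` {v. qform a b c v = 1} = {v. qform a b c v = -1}"
    using conjugate_hyperbola[OF disc] by blast
  define L where "L s = (if snorm s > 0 then id else J)" for s
  have L: "L s ` {v. qform a b c v = 1} = {v. qform a b c v = sgn (snorm s)}" if "s \<in> D - {0}" for s
    using snorm_nonzero[OF that] J(2) unfolding L_def by auto
  have "\<forall>s \<in> D - {0}. L s = id \<or> (linear (L s) \<and> L s ` {v. qform a b c v = 1} = {v. qform a b c v = -1})"
    unfolding L_def using J by simp
  moreover have "A_half a1 a2 = (\<Union>s \<in> D - {0}. dilate (sqrt \<bar>N s\<bar>) (L s ` {v. qform a b c v = 1}))"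
    unfolding A_half_level_sets[OF form] using L by simp
  ultimately show ?thesis using disc by blast
qed

end

section \<open>Existence of the two further embeddings\<close>

lemma cubic_conjugates_nonreal:
  assumes cub: "cubic_field_basis a1 a2" and emb: "complex_embedding a1 a2 \<sigma>"
    and x: "x \<in> Kset a1 a2" "Im (\<sigma> x) \<noteq> 0"
  shows "cubic_conjugates a1 a2 \<sigma> (\<lambda>x. cnj (\<sigma> x))"
proof -
  have "x \<in> Kset a1 (a1\<^sup>2)" using x cubic_power_basis(2)[OF cub] by simp
  then obtain c0 c1 c2 where c: "c0 \<in> \<rat>" "c1 \<in> \<rat>" "c2 \<in> \<rat>" "x = c0 + c1 * a1 + c2 * a1\<^sup>2"
    by (rule KsetE)
  have sx: "\<sigma> x = of_real c0 + of_real c1 * \<sigma> a1 + of_real c2 * (\<sigma> a1 * \<sigma> a1)"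
    using embedding_lincomb[OF cub emb c(1-3) Kset_gens(1) cubic_mult[OF cub Kset_gens(1) Kset_gens(1)]]
      embedding_mult[OF emb Kset_gens(1) Kset_gens(1)] c(4) by (simp add: power2_eq_square)
  \<comment> \<open>\<open>x\<close> is a polynomial in \<open>a1\<close> with rational
    coefficients, so a real value at \<open>a1\<close> would make \<open>\<sigma> x\<close> real. A
    nonreal value at \<open>a1\<close> separates \<sigma>, its complex conjugate and the
    inclusion.\<close>
  have im: "Im (\<sigma> a1) \<noteq> 0" using x(2) unfolding sx by auto
  have emb': "complex_embedding a1 a2 (\<lambda>x. cnj (\<sigma> x))"
    using emb unfolding complex_embedding_def by simp
  show ?thesis
    by unfold_locales (use cub emb emb' im in \<open>auto simp: complex_eq_iff\<close>)
qed

text \<open>The coefficients on the right depend only on the cubic relation and not on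
  \<open>t\<close>. The lemma is stated for any commutative ring so that it applies both to the real
  \<open>a1\<close> and to a complex root, whence evaluation at such a root is
  multiplicative.\<close>

lemma cubic_reduce:
  fixes t :: "'a::comm_ring_1"
  assumes t: "t ^ 3 = p0 + p1 * t + p2 * t\<^sup>2"
  shows "(c0 + c1 * t + c2 * t\<^sup>2) * (d0 + d1 * t + d2 * t\<^sup>2) =
    (c0 * d0 + (c1 * d2 + c2 * d1) * p0 + c2 * d2 * (p2 * p0))
    + (c0 * d1 + c1 * d0 + (c1 * d2 + c2 * d1) * p1 + c2 * d2 * (p0 + p2 * p1)) * t
    + (c0 * d2 + c1 * d1 + c2 * d0 + (c1 * d2 + c2 * d1) * p2 + c2 * d2 * (p1 + p2 * p2)) * t\<^sup>2"
proof -
  have t4: "t * t ^ 3 = p2 * p0 + (p0 + p2 * p1) * t + (p1 + p2 * p2) * t\<^sup>2"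
  proof -
    have "t * t ^ 3 = p0 * t + p1 * t\<^sup>2 + p2 * t ^ 3"
      by (subst t) (simp add: algebra_simps power2_eq_square power3_eq_cube)
    then show ?thesis unfolding t by (simp add: algebra_simps)
  qed
  have "(c0 + c1 * t + c2 * t\<^sup>2) * (d0 + d1 * t + d2 * t\<^sup>2) =
    c0 * d0 + (c0 * d1 + c1 * d0) * t + (c0 * d2 + c1 * d1 + c2 * d0) * t\<^sup>2
     + (c1 * d2 + c2 * d1) * t ^ 3 + c2 * d2 * (t * t ^ 3)"
    by (simp add: algebra_simps power2_eq_square power3_eq_cube)
  then show ?thesis unfolding t4 unfolding t by (simp add: algebra_simps)
qed

definition root_embedding :: "real \<Rightarrow> complex \<Rightarrow> real \<Rightarrow> complex" where
  "root_embedding a \<beta> x = (let c = kcoord a (a\<^sup>2) x in of_real (c 0) + of_real (c 1) * \<beta> + of_real (c 2) * \<beta>\<^sup>2)"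

lemma root_embedding_eq:
  assumes "cubic_field_basis a (a\<^sup>2)" "c0 \<in> \<rat>" "c1 \<in> \<rat>" "c2 \<in> \<rat>"
  shows "root_embedding a \<beta> (c0 + c1 * a + c2 * a\<^sup>2) = of_real c0 + of_real c1 * \<beta> + of_real c2 * \<beta>\<^sup>2"
  unfolding root_embedding_def kcoord_eq[OF assms] by simp

lemma complex_embedding_root_embedding:
  assumes cub: "cubic_field_basis a1 a2" and p: "p0 \<in> \<rat>" "p1 \<in> \<rat>" "p2 \<in> \<rat>"
    and a: "a1 ^ 3 = p0 + p1 * a1 + p2 * a1\<^sup>2"
    and \<beta>: "\<beta> ^ 3 = of_real p0 + of_real p1 * \<beta> + of_real p2 * \<beta>\<^sup>2"
  shows "complex_embedding a1 a2 (root_embedding a1 \<beta>)"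
proof -
  note pb = cubic_power_basis[OF cub]
  note re = root_embedding_eq[OF pb(1)]
  have "root_embedding a1 \<beta> 1 = 1" using re[of 1 0 0] by simp
  moreover have "root_embedding a1 \<beta> (x + y) = root_embedding a1 \<beta> x + root_embedding a1 \<beta> y \<and>
      root_embedding a1 \<beta> (x * y) = root_embedding a1 \<beta> x * root_embedding a1 \<beta> y"
    if x: "x \<in> Kset a1 (a1\<^sup>2)" and y: "y \<in> Kset a1 (a1\<^sup>2)" for x y
  proof -
    from x obtain c0 c1 c2 where c: "c0 \<in> \<rat>" "c1 \<in> \<rat>" "c2 \<in> \<rat>" "x = c0 + c1 * a1 + c2 * a1\<^sup>2"
      by (rule KsetE)
    from y obtain d0 d1 d2 where d: "d0 \<in> \<rat>" "d1 \<in> \<rat>" "d2 \<in> \<rat>" "y = d0 + d1 * a1 + d2 * a1\<^sup>2"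
      by (rule KsetE)
    have "x + y = (c0 + d0) + (c1 + d1) * a1 + (c2 + d2) * a1\<^sup>2"
      unfolding c(4) d(4) by (simp add: algebra_simps)
    then have "root_embedding a1 \<beta> (x + y) = root_embedding a1 \<beta> x + root_embedding a1 \<beta> y"
      using re[of "c0 + d0" "c1 + d1" "c2 + d2" \<beta>] re[OF c(1-3), of \<beta>] re[OF d(1-3), of \<beta>] c d
      by (simp add: algebra_simps)
    moreover have "root_embedding a1 \<beta> (x * y) = root_embedding a1 \<beta> x * root_embedding a1 \<beta> y"
      unfolding c(4) d(4) re[OF c(1-3)] re[OF d(1-3)] cubic_reduce[OF a] cubic_reduce[OF \<beta>]
      by (subst re) (use c(1-3) d(1-3) p in simp_all)
    ultimately show ?thesis by blast
  qed
  ultimately show ?thesis unfolding complex_embedding_def pb(2)[symmetric] by blast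
qed

text \<open>Being totally real restricts the embeddings without providing any, so they are
  constructed from the two remaining roots of the minimal polynomial of \<open>a1\<close>. A
  negative discriminant of the quadratic factor would produce a nonreal embedding.\<close>

lemma totally_real_conjugates:
  assumes cub: "cubic_field_basis a1 a2" and tr: "totally_real a1 a2"
  shows "\<exists>\<sigma> \<tau>. cubic_conjugates a1 a2 \<sigma> \<tau> \<and> (\<forall>x \<in> Kset a1 a2. \<sigma> x \<in> \<real> \<and> \<tau> x \<in> \<real>)"
proof -
  note pb = cubic_power_basis[OF cub]
  have "a1 * (a1 * a1) \<in> Kset a1 (a1\<^sup>2)"
    unfolding pb(2) by (intro cubic_mult[OF cub] Kset_gens)
  then obtain p0 p1 p2 where p: "p0 \<in> \<rat>" "p1 \<in> \<rat>" "p2 \<in> \<rat>" and a': "a1 * (a1 * a1) = p0 + p1 * a1 + p2 * a1\<^sup>2"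
    by (rule KsetE)
  have a: "a1 ^ 3 = p0 + p1 * a1 + p2 * a1\<^sup>2" using a' by (simp add: power3_eq_cube mult.assoc)
  \<comment> \<open>The coefficients of the quotient of the cubic polynomial by its linear factor at
    \<open>a1\<close>.\<close>
  define b c where "b = a1 - p2" and "c = a1\<^sup>2 - p2 * a1 - p1"
  have p0: "p0 = a1 ^ 3 - p1 * a1 - p2 * a1\<^sup>2" using a by simp
  have fact: "t ^ 3 - (of_real p0 + of_real p1 * t + of_real p2 * t\<^sup>2) =
      (t - of_real a1) * (t\<^sup>2 + of_real b * t + of_real c)" for t :: complex
    unfolding p0 b_def c_def by (simp add: algebra_simps power2_eq_square power3_eq_cube)
  have emb: "complex_embedding a1 a2 (root_embedding a1 t)"
    if "t\<^sup>2 + of_real b * t + of_real c = 0" for t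
    by (rule complex_embedding_root_embedding[OF cub p a]) (use fact[of t] that in simp)
  have ev: "root_embedding a1 t a1 = t" for t
    using root_embedding_eq[OF pb(1), of 0 1 0 t] by simp
  have real: "root_embedding a1 t x \<in> \<real>" if "t\<^sup>2 + of_real b * t + of_real c = 0" "x \<in> Kset a1 a2" for t x
    using tr emb[OF that(1)] that(2) unfolding totally_real_def complex_is_Real_iff by blast
  define \<Delta> where "\<Delta> = b\<^sup>2 - 4 * c"
  have root: "((- of_real b + z) / 2)\<^sup>2 + of_real b * ((- of_real b + z) / 2) + of_real c = 0"
    if "z\<^sup>2 = of_real \<Delta>" for z :: complex
  proof -
    have "4 * (((- of_real b + z) / 2)\<^sup>2 + of_real b * ((- of_real b + z) / 2) + of_real c) = z\<^sup>2 - of_real \<Delta>"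
      unfolding \<Delta>_def by (simp add: power2_eq_square field_simps)
    then show ?thesis using that by (metis diff_self mult_eq_0_iff zero_neq_numeral)
  qed
  have "\<Delta> \<ge> 0"
  proof (rule ccontr)
    assume neg: "\<not> \<Delta> \<ge> 0"
    define z where "z = \<i> * of_real (sqrt (- \<Delta>))"
    have "z\<^sup>2 = of_real \<Delta>"
      unfolding z_def power_mult_distrib using neg by (simp flip: of_real_power)
    then have "(- of_real b + z) / 2 \<in> \<real>"
      using real[OF root Kset_gens(1)] ev by simp
    then show False using neg unfolding z_def complex_is_Real_iff by simp
  qed
  \<comment> \<open>the minimal polynomial of a1 has no double root, since its derivative does not vanish at a1\<close>
  define dP where "dP = (- p1) + (- 2 * p2) * a1 + 3 * a1\<^sup>2"
  have dPK: "dP \<in> Kset a1 a2" unfolding dP_def pb(2)[symmetric] by (intro KsetI) (use p in auto)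
  have dPa: "dP \<noteq> 0"
  proof
    assume "dP = 0"
    then have "(3::real) = 0"
      using cubic_indep(3)[OF pb(1), of "- p1" "- 2 * p2" 3] p unfolding dP_def by simp
    then show False by simp
  qed
  \<comment> \<open>\<open>dP\<close> is the derivative evaluated at \<open>a1\<close>, a nonzero
    element of K. The embedding attached to the root \<open>t\<close> sends it to the derivative at
    \<open>t\<close>, which is therefore nonzero too.\<close>
  have dPb: "of_real (- p1) + of_real (- 2 * p2) * t + of_real 3 * t\<^sup>2 \<noteq> 0"
    if "t\<^sup>2 + of_real b * t + of_real c = 0" for t :: complex
    using embedding_nonzero[OF cub emb[OF that] dPK dPa] root_embedding_eq[OF pb(1), of "- p1" "- 2 * p2" 3 t] p
    unfolding dP_def by simp
  define z where "z = complex_of_real (sqrt \<Delta>)"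
  have z2: "z\<^sup>2 = of_real \<Delta>" "(- z)\<^sup>2 = of_real \<Delta>"
    unfolding z_def using \<open>\<Delta> \<ge> 0\<close> by (simp_all flip: of_real_power)
  define \<beta> \<gamma> where "\<beta> = (- of_real b + z) / 2" and "\<gamma> = (- of_real b + - z) / 2"
  have roots: "\<beta>\<^sup>2 + of_real b * \<beta> + of_real c = 0" "\<gamma>\<^sup>2 + of_real b * \<gamma> + of_real c = 0"
    unfolding \<beta>_def \<gamma>_def by (rule root, rule z2)+
  \<comment> \<open>The derivative of the cubic at \<open>a1\<close> is the value of the quadratic
    factor there, so no root of that factor equals \<open>a1\<close>.\<close>
  have "a1\<^sup>2 + b * a1 + c = dP" unfolding dP_def b_def c_def by (simp add: power2_eq_square algebra_simps)
  then have nr: "t \<noteq> of_real a1" if "t\<^sup>2 + of_real b * t + of_real c = 0" for t :: complex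
    using that dPa by (auto simp flip: of_real_power of_real_mult of_real_add)
  \<comment> \<open>Equal roots would also be a zero of the derivative of the quadratic factor, and
    then, by the product rule, of the derivative of the cubic.\<close>
  have "\<beta> \<noteq> \<gamma>"
  proof
    assume "\<beta> = \<gamma>"
    then have "2 * \<beta> + of_real b = 0" unfolding \<beta>_def \<gamma>_def by (simp add: field_simps)
    moreover have "of_real (- p1) + of_real (- 2 * p2) * \<beta> + of_real 3 * \<beta>\<^sup>2 =
        (\<beta>\<^sup>2 + of_real b * \<beta> + of_real c) + (\<beta> - of_real a1) * (2 * \<beta> + of_real b)"
      unfolding b_def c_def by (simp add: power2_eq_square algebra_simps)
    ultimately show False using dPb[OF roots(1)] roots(1) by simp
  qed
  then have "cubic_conjugates a1 a2 (root_embedding a1 \<beta>) (root_embedding a1 \<gamma>)"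
    by unfold_locales (use cub emb roots nr real ev in auto)
  then show ?thesis using real roots by blast
qed

theorem theorem5:
  fixes a1 a2 :: real
  assumes "cubic_field_basis a1 a2"
  shows "(has_nonreal_embedding a1 a2 \<longrightarrow>
            (\<exists>E. is_ellipse E \<and>
               A_half a1 a2 = (\<Union>s \<in> dual_lat a1 a2 - {0}. dilate (sqrt \<bar>knorm a1 a2 s\<bar>) E)))
       \<and> (totally_real a1 a2 \<longrightarrow>
            (\<exists>a b c (L :: real \<Rightarrow> real \<times> real \<Rightarrow> real \<times> real).
               a * c - b^2 < 0 \<and>
               (\<forall>s \<in> dual_lat a1 a2 - {0}. L s = id \<or>
                  (linear (L s) \<and> L s ` {v. qform a b c v = 1} = {v. qform a b c v = -1})) \<and>
               A_half a1 a2 = (\<Union>s \<in> dual_lat a1 a2 - {0}.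
                  dilate (sqrt \<bar>knorm a1 a2 s\<bar>) (L s ` {v. qform a b c v = 1}))))"
proof (intro conjI impI)
  assume "has_nonreal_embedding a1 a2"
  then obtain \<sigma> x where "complex_embedding a1 a2 \<sigma>" "x \<in> Kset a1 a2" "Im (\<sigma> x) \<noteq> 0"
    unfolding has_nonreal_embedding_def by blast
  then interpret cubic_conjugates a1 a2 \<sigma> "\<lambda>x. cnj (\<sigma> x)"
    by (rule cubic_conjugates_nonreal[OF assms])
  show "\<exists>E. is_ellipse E \<and>
     A_half a1 a2 = (\<Union>s \<in> dual_lat a1 a2 - {0}. dilate (sqrt \<bar>knorm a1 a2 s\<bar>) E)"
    by (rule A_half_complex) (rule refl)
next
  assume "totally_real a1 a2"
  then obtain \<sigma> \<tau> where "cubic_conjugates a1 a2 \<sigma> \<tau>" and r: "\<forall>x \<in> Kset a1 a2. \<sigma> x \<in> \<real> \<and> \<tau> x \<in> \<real>"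
    using totally_real_conjugates[OF assms] by blast
  then interpret cubic_conjugates a1 a2 \<sigma> \<tau> by simp
  show "\<exists>a b c (L :: real \<Rightarrow> real \<times> real \<Rightarrow> real \<times> real).
               a * c - b^2 < 0 \<and>
               (\<forall>s \<in> dual_lat a1 a2 - {0}. L s = id \<or>
                  (linear (L s) \<and> L s ` {v. qform a b c v = 1} = {v. qform a b c v = -1})) \<and>
               A_half a1 a2 = (\<Union>s \<in> dual_lat a1 a2 - {0}.
                  dilate (sqrt \<bar>knorm a1 a2 s\<bar>) (L s ` {v. qform a b c v = 1}))"
    using r by (intro A_half_real) blast
qed

end
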